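(* Let $p$ be a prime with $p\equiv 1\pmod 3$, and suppose there is $t\in\mathbb{N}$ such that $p^t=x^2+27y^2$ for some integers $x,y$ with $\gcd(x,p)=1$. Then for every $s\in\{0,1,\dots,t-1\}$ there are infinitely many $\ell\in\mathbb{N}$ such that $\Gamma(3,p^{3(t\ell+s)})$ and its complement $\bar\Gamma(3,p^{3(t\ell+s)})$ are equienergetic and non-isospectral.
   Context: For a prime power $q$ and $k\mid q-1$, let $R_k=\{x^k: x\in\mathbb{F}_q^*\}$. $\Gamma(k,q)$ is the graph on $\mathbb{F}_q$ in which $v,w$ are adjacent iff $w-v\in R_k$; $\bar\Gamma$ denotes the complement graph. The energy of a graph is the sum of the absolute values of its adjacency eigenvalues; equienergetic means equal energy, isospectral means equal spectrum. *)

theory Defs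
  imports
    "HOL-Algebra.Ring"
    "HOL-Number_Theory.Cong"
    "Graph_Theory.Pair_Digraph"
    "Jordan_Normal_Form.Char_Poly"
    "HOL-Computational_Algebra.Polynomial"
    Complex_Main
begin

definition power_residues :: "nat \<Rightarrow> ('a, 'b) ring_scheme \<Rightarrow> 'a set" where
  "power_residues k F = {x [^]\<^bsub>F\<^esub> k | x. x \<in> carrier F - {\<zero>\<^bsub>F\<^esub>}}"

text \<open>An undirected graph is represented as a pair digraph with a symmetric arc relation.
  The graph below is meant for a finite field \<open>F\<close> with \<open>k\<close> dividing \<open>card (carrier F) - 1\<close>; its arc relation
  is symmetric as soon as \<open>- 1\<close> is a \<open>k\<close>-th power, in particular for \<open>k = 3\<close>
  (lemma \<open>pair_graph_gen_paley\<close>).\<close>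

definition gen_paley :: "nat \<Rightarrow> ('a, 'b) ring_scheme \<Rightarrow> 'a pair_pre_digraph" where
  "gen_paley k F = \<lparr> pverts = carrier F,
     parcs = {(v, w). v \<in> carrier F \<and> w \<in> carrier F \<and> w \<ominus>\<^bsub>F\<^esub> v \<in> power_residues k F} \<rparr>"

definition complement_graph :: "'a pair_pre_digraph \<Rightarrow> 'a pair_pre_digraph" where
  "complement_graph G = \<lparr> pverts = pverts G,
     parcs = {(v, w). v \<in> pverts G \<and> w \<in> pverts G \<and> v \<noteq> w \<and> (v, w) \<notin> parcs G} \<rparr>"

text \<open>Matrices are indexed by natural numbers, so the vertices have to be listed in some order.
  Another order conjugates the adjacency matrix by a permutation matrix and therefore yields the
  same spectrum.\<close>

definition vertex_list :: "'a pair_pre_digraph \<Rightarrow> 'a list" where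
  "vertex_list G = (SOME vs. distinct vs \<and> set vs = pverts G)"

definition adjacency_matrix :: "'a pair_pre_digraph \<Rightarrow> complex mat" where
  "adjacency_matrix G = (let vs = vertex_list G; n = length vs in
     mat n n (\<lambda>(i, j). if (vs ! i, vs ! j) \<in> parcs G then 1 else 0))"

text \<open>The eigenvalues with their (algebraic) multiplicities.\<close>

definition graph_spectrum :: "'a pair_pre_digraph \<Rightarrow> complex multiset" where
  "graph_spectrum G = proots (char_poly (adjacency_matrix G))"

definition graph_energy :: "'a pair_pre_digraph \<Rightarrow> real" where
  "graph_energy G = (\<Sum>z\<in>#graph_spectrum G. cmod z)"

definition equienergetic :: "'a pair_pre_digraph \<Rightarrow> 'b pair_pre_digraph \<Rightarrow> bool" where
  "equienergetic G H \<longleftrightarrow> graph_energy G = graph_energy H"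

definition isospectral :: "'a pair_pre_digraph \<Rightarrow> 'b pair_pre_digraph \<Rightarrow> bool" where
  "isospectral G H \<longleftrightarrow> graph_spectrum G = graph_spectrum H"

lemma uminus_power_residues:
  assumes "field F" "odd k" "a \<in> power_residues k F"
  shows "\<ominus>\<^bsub>F\<^esub> a \<in> power_residues k F"
proof -
  interpret field F by fact
  obtain x where x: "x \<in> carrier F" "x \<noteq> \<zero>\<^bsub>F\<^esub>" "a = x [^]\<^bsub>F\<^esub> k"
    using assms(3) by (auto simp: power_residues_def)
  obtain m where m: "k = Suc (2 * m)"
    using assms(2) by (auto elim: oddE)
  have sq: "(\<ominus>\<^bsub>F\<^esub> x) [^]\<^bsub>F\<^esub> (2::nat) = x [^]\<^bsub>F\<^esub> (2::nat)"
    using x(1) by (simp add: numeral_2_eq_2 l_minus r_minus)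
  have "(\<ominus>\<^bsub>F\<^esub> x) [^]\<^bsub>F\<^esub> k = ((\<ominus>\<^bsub>F\<^esub> x) [^]\<^bsub>F\<^esub> (2::nat)) [^]\<^bsub>F\<^esub> m \<otimes>\<^bsub>F\<^esub> (\<ominus>\<^bsub>F\<^esub> x)"
    using x(1) by (simp add: m nat_pow_pow)
  also have "\<dots> = (x [^]\<^bsub>F\<^esub> (2::nat)) [^]\<^bsub>F\<^esub> m \<otimes>\<^bsub>F\<^esub> (\<ominus>\<^bsub>F\<^esub> x)"
    by (simp only: sq)
  also have "\<dots> = \<ominus>\<^bsub>F\<^esub> a"
    using x(1) by (simp add: x(3) m nat_pow_pow r_minus)
  finally have "\<ominus>\<^bsub>F\<^esub> a = (\<ominus>\<^bsub>F\<^esub> x) [^]\<^bsub>F\<^esub> k" by simp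
  moreover have "\<ominus>\<^bsub>F\<^esub> x \<in> carrier F - {\<zero>\<^bsub>F\<^esub>}"
    using x by (metis Diff_iff a_inv_closed minus_minus minus_zero singletonD)
  ultimately show ?thesis by (auto simp: power_residues_def)
qed

lemma pair_graph_gen_paley:
  assumes "field F" "finite (carrier F)" "odd k"
  shows "pair_graph (gen_paley k F)"
proof -
  interpret field F by fact
  have nz: "\<zero>\<^bsub>F\<^esub> \<notin> power_residues k F"
  proof
    assume "\<zero>\<^bsub>F\<^esub> \<in> power_residues k F"
    then obtain x where x: "x \<in> carrier F" "x \<noteq> \<zero>\<^bsub>F\<^esub>" "x [^]\<^bsub>F\<^esub> k = \<zero>\<^bsub>F\<^esub>"
      by (auto simp: power_residues_def)
    have "x [^]\<^bsub>F\<^esub> n \<noteq> \<zero>\<^bsub>F\<^esub>" for n :: nat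
      using x(1,2) by (induction n) (auto simp: integral_iff)
    with x(3) show False by blast
  qed
  have sym: "v \<ominus>\<^bsub>F\<^esub> w \<in> power_residues k F"
    if "v \<in> carrier F" "w \<in> carrier F" "w \<ominus>\<^bsub>F\<^esub> v \<in> power_residues k F" for v w
  proof -
    have "v \<ominus>\<^bsub>F\<^esub> w = \<ominus>\<^bsub>F\<^esub> (w \<ominus>\<^bsub>F\<^esub> v)"
      using that by (simp add: a_minus_def minus_add a_comm)
    thus ?thesis using uminus_power_residues[OF assms(1,3) that(3)] by simp
  qed
  have fin: "finite (parcs (gen_paley k F))"
    by (rule finite_subset[of _ "carrier F \<times> carrier F"]) (auto simp: gen_paley_def assms(2))
  show ?thesis
    using assms(2) fin nz sym
    by unfold_locales
       (auto simp: gen_paley_def symmetric_def sym_def r_neg a_minus_def)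
qed

lemma pair_graph_complement_graph:
  assumes "pair_graph G"
  shows "pair_graph (complement_graph G)"
proof -
  interpret pair_graph G by fact
  have fin: "finite (parcs (complement_graph G))"
    by (rule finite_subset[of _ "pverts G \<times> pverts G"]) (auto simp: complement_graph_def)
  show ?thesis
    using fin pair_sym_arcs
    by unfold_locales (auto simp: complement_graph_def symmetric_def sym_def)
qed

end

theory Submission
  imports Defs "HOL-Algebra.Multiplicative_Group" "Jordan_Normal_Form.Schur_Decomposition"
begin

text \<open>Let \<open>q = p ^ N\<close>, let \<open>\<chi>\<close> be a cubic character of the field and \<open>J\<close> its Jacobi sum, and put
  \<open>c = 2 * Re J\<close>. Apart from the valency, the eigenvalues of the graph are \<open>(y - 1) / 3\<close> and those of the
  complement are \<open>- (y + 2) / 3\<close>, where \<open>y\<close> runs through the roots of \<open>y^3 = 3 * q * y + q * c\<close>, each with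
  multiplicity \<open>(q - 1) / 3\<close>. The three roots have sum zero, and if \<open>c \<ge> 6\<close> then one of them is at least
  \<open>1\<close> and the other two are at most \<open>- 2\<close>, which makes the two energies equal.

  The integer \<open>c\<close> is determined by \<open>q\<close>: it satisfies \<open>c^2 + 27 * d^2 = 4 * q\<close>, it is congruent to \<open>1\<close>
  modulo \<open>3\<close>, and \<open>p\<close> does not divide it, because up to sign it is a central binomial coefficient
  modulo \<open>p\<close>. Passing from \<open>l\<close> to \<open>l + 1\<close> therefore multiplies \<open>(c + d * sqrt (- 27)) / 2\<close> by a fixed
  non-real number \<open>(x + y * sqrt (- 27))^3\<close> (for suitable signs of \<open>x\<close> and \<open>y\<close>), so the real part
  \<open>c / 2\<close> is large for infinitely many \<open>l\<close>.\<close>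


section \<open>Representations by the form \<open>x^2 + 27 * y^2\<close>\<close>

text \<open>The field is given only abstractly, without a trace map or an additive character.
  Eigenspaces are therefore described by idempotents in the convolution algebra spanned by the
  constants, the delta function, \<chi> and its conjugate, and the value of \<open>c\<close> modulo
  \<open>p\<close> comes from power sums inside the field. Non-isospectrality holds for every
  \<open>q\<close>, because the valency of the complement is too large to be an eigenvalue of the
  graph; only the size of \<open>c\<close> is at stake. The threshold 6 is what pushes negative
  roots down to \<open>- 2\<close>: from \<open>- y * (3 * q - y^2) = q * c\<close> follows
  \<open>- 3 * y \<ge> c\<close>. Growth of the modulus alone does not make \<open>c\<close> large,
  since the argument might keep the real part negative. Comparing sums of real parts with sums of
  their squares excludes this, for rational and irrational angles alike. Coprimality to
  \<open>p\<close> identifies the \<open>c\<close> of the field with the one produced by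
  multiplication, and the residue modulo 3 fixes its sign.\<close>

lemma quadratic_form_rep_unique:
  fixes c d c' d' p :: int
  assumes p: "Factorial_Ring.prime p" "p \<noteq> 2" and N: "N > 0"
    and rep: "c\<^sup>2 + 27 * d\<^sup>2 = 4 * p ^ N" and rep': "c'\<^sup>2 + 27 * d'\<^sup>2 = 4 * p ^ N"
    and c: "\<not> p dvd c" and c': "\<not> p dvd c'"
  shows "c\<^sup>2 = c'\<^sup>2"
proof -
  define u v where "u = c * d' - c' * d" and "v = c * d' + c' * d"
  have p_pos: "p > 0" using p(1) by (simp add: prime_gt_0_int)
  \<comment> \<open>\<open>u\<close> and \<open>v\<close> are the cross terms in the two ways of
    composing the representations. As \<open>p\<close> cannot divide both, all of
    \<open>p ^ N\<close> goes into one of them.\<close>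
  have uv: "u * v = 4 * p ^ N * (d'\<^sup>2 - d\<^sup>2)"
  proof -
    have e: "c\<^sup>2 = 4 * p ^ N - 27 * d\<^sup>2" "c'\<^sup>2 = 4 * p ^ N - 27 * d'\<^sup>2"
      using rep rep' by linarith+
    have "u * v = c\<^sup>2 * d'\<^sup>2 - c'\<^sup>2 * d\<^sup>2"
      by (simp add: u_def v_def power2_eq_square algebra_simps)
    also have "\<dots> = (4 * p ^ N - 27 * d\<^sup>2) * d'\<^sup>2 - (4 * p ^ N - 27 * d'\<^sup>2) * d\<^sup>2"
      unfolding e ..
    finally show ?thesis by (simp add: algebra_simps)
  qed
  have not_both: "\<not> (p dvd u \<and> p dvd v)"
  proof
    assume "p dvd u \<and> p dvd v"
    hence "p dvd u + v" by (meson dvd_add)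
    hence "p dvd 2 * (c * d')" by (simp add: u_def v_def)
    moreover have "\<not> p dvd 2" using p by (metis primes_dvd_imp_eq two_is_prime)
    ultimately have "p dvd d'" using p(1) c by (simp add: prime_dvd_mult_iff)
    hence "p dvd 27 * d'\<^sup>2" by (simp add: power2_eq_square)
    moreover have "p dvd c'\<^sup>2 + 27 * d'\<^sup>2" using N by (simp add: rep')
    ultimately have "p dvd c'\<^sup>2" using dvd_add_left_iff by blast
    thus False using c' p(1) prime_dvd_power by blast
  qed
  \<comment> \<open>The size argument is 27 > 16: a nonzero multiple of \<open>p ^ N\<close> is
    already too large.\<close>
  have zero: "u' = 0" if "p ^ N dvd u'" "z\<^sup>2 + 27 * u'\<^sup>2 = 16 * (p ^ N)\<^sup>2" for u' z
  proof (rule ccontr)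
    assume "u' \<noteq> 0"
    hence "p ^ N \<le> \<bar>u'\<bar>" using dvd_imp_le_int[of u' "p ^ N"] that(1) p_pos by simp
    hence "(p ^ N)\<^sup>2 \<le> u'\<^sup>2" using power_mono[of "p ^ N" "\<bar>u'\<bar>" 2] p_pos by simp
    moreover have "(p ^ N)\<^sup>2 > 0" using p_pos by (intro zero_less_power)
    moreover have "z\<^sup>2 \<ge> 0" by simp
    ultimately show False using that(2) by linarith
  qed
  have brahm: "(c * c' + 27 * (d * d'))\<^sup>2 + 27 * u\<^sup>2 = 16 * (p ^ N)\<^sup>2"
    "(c * c' + 27 * (- (d * d')))\<^sup>2 + 27 * v\<^sup>2 = 16 * (p ^ N)\<^sup>2"
  proof -
    have "(c * c' + 27 * (d * d'))\<^sup>2 + 27 * u\<^sup>2 = (c\<^sup>2 + 27 * d\<^sup>2) * (c'\<^sup>2 + 27 * d'\<^sup>2)"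
      by (simp add: u_def power2_eq_square algebra_simps)
    thus "(c * c' + 27 * (d * d'))\<^sup>2 + 27 * u\<^sup>2 = 16 * (p ^ N)\<^sup>2"
      unfolding rep rep' by (simp add: power2_eq_square)
    have "(c * c' + 27 * (- (d * d')))\<^sup>2 + 27 * v\<^sup>2 = (c\<^sup>2 + 27 * d\<^sup>2) * (c'\<^sup>2 + 27 * d'\<^sup>2)"
      by (simp add: v_def power2_eq_square algebra_simps)
    thus "(c * c' + 27 * (- (d * d')))\<^sup>2 + 27 * v\<^sup>2 = 16 * (p ^ N)\<^sup>2"
      unfolding rep rep' by (simp add: power2_eq_square)
  qed
  have dvd: "p ^ N dvd u * v" by (simp add: uv)
  have "u = 0 \<or> v = 0"
  proof (cases "p dvd u")
    case True
    hence "coprime (p ^ N) v" using not_both p(1) by (simp add: prime_imp_coprime)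
    hence "p ^ N dvd u" using dvd by (metis coprime_dvd_mult_left_iff)
    thus ?thesis using zero brahm(1) by blast
  next
    case False
    hence "coprime (p ^ N) u" using p(1) by (simp add: prime_imp_coprime)
    hence "p ^ N dvd v" using dvd by (metis coprime_dvd_mult_right_iff)
    thus ?thesis using zero brahm(2) by blast
  qed
  hence "u * v = 0" by simp
  hence "d'\<^sup>2 = d\<^sup>2" using uv p_pos by simp
  thus ?thesis using rep rep' by simp
qed

text \<open>If the real parts stayed below \<open>K\<close>, their rescalings \<open>u l\<close> to
  the unit circle would have summable positive parts. Their plain sums are bounded as geometric
  sums, so the sums of \<open>\<bar>u l\<bar>\<close>, and with them those of the squares, would be
  bounded too. But the squares have mean value half of \<open>(cmod \<beta>)^2\<close>. Non-real
  \<gamma> guarantees that neither \<open>z\<close> nor its square is 1.\<close>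

lemma exists_large_Re_mult_power:
  fixes \<beta> \<gamma> :: complex
  assumes \<beta>: "\<beta> \<noteq> 0" and \<gamma>: "cmod \<gamma> > 1" "Im \<gamma> \<noteq> 0"
  shows "\<exists>l. Re (\<beta> * \<gamma> ^ l) \<ge> K"
proof (rule ccontr)
  assume "\<not> (\<exists>l. Re (\<beta> * \<gamma> ^ l) \<ge> K)"
  hence small: "Re (\<beta> * \<gamma> ^ l) < K" for l by (simp add: not_le)
  define K' where "K' = max K 1"
  have K': "K' > 0" "K \<le> K'" by (auto simp: K'_def)
  define \<rho> where "\<rho> = cmod \<gamma>"
  define z where "z = \<gamma> / of_real \<rho>"
  have \<rho>: "\<rho> > 1" using \<gamma> by (simp add: \<rho>_def)
  have z: "cmod z = 1" using \<rho> by (simp add: z_def norm_divide flip: \<rho>_def)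
  have Imz: "Im z \<noteq> 0" using \<gamma>(2) \<rho> by (simp add: z_def)
  have z1: "z \<noteq> 1" using Imz by auto
  have z2: "z\<^sup>2 \<noteq> 1" using Imz by (auto simp: power2_eq_1_iff)
  define u where "u l = Re (\<beta> * z ^ l)" for l
  have geo: "cmod (\<Sum>l<N. \<delta> * w ^ l) \<le> 2 * cmod \<delta> / cmod (1 - w)"
    if "cmod w = 1" "w \<noteq> 1" for w \<delta> N
  proof -
    have "(\<Sum>l<N. \<delta> * w ^ l) = \<delta> * ((1 - w ^ N) / (1 - w))"
      using that(2) by (simp add: sum_gp_strict flip: sum_distrib_left)
    moreover have "cmod (1 - w ^ N) \<le> 2"
      using norm_triangle_ineq4[of 1 "w ^ N"] that(1) by (simp add: norm_power)
    ultimately show ?thesis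
      by (simp add: norm_mult norm_divide divide_right_mono mult_left_mono
            mult.commute [of 2] times_divide_eq_right [symmetric] del: times_divide_eq_right)
  qed
  have u_lt: "u l \<le> K' * (1 / \<rho>) ^ l" for l
  proof -
    have "\<rho> ^ l * u l = Re (\<beta> * \<gamma> ^ l)"
    proof -
      have "\<gamma> ^ l = of_real (\<rho> ^ l) * z ^ l" using \<rho> by (simp add: z_def power_divide)
      hence "\<beta> * \<gamma> ^ l = of_real (\<rho> ^ l) * (\<beta> * z ^ l)" by simp
      moreover have "Re (of_real a * w) = a * Re w" for a w by simp
      ultimately show ?thesis unfolding u_def by (metis (no_types))
    qed
    hence "\<rho> ^ l * u l \<le> K'" using small[of l] K' by linarith
    thus ?thesis using \<rho> by (simp add: power_divide field_simps)
  qed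
  \<comment> \<open>The absolute value of a real is twice its positive part minus the real
    itself.\<close>
  have abs_u: "(u l)\<^sup>2 \<le> cmod \<beta> * (2 * (K' * (1 / \<rho>) ^ l) - u l)" for l
  proof -
    have "\<bar>u l\<bar> \<le> cmod \<beta>"
      using abs_Re_le_cmod[of "\<beta> * z ^ l"] z by (simp add: u_def norm_mult norm_power)
    hence "(u l)\<^sup>2 \<le> cmod \<beta> * \<bar>u l\<bar>"
      by (metis abs_ge_zero abs_mult_self_eq mult_right_mono power2_eq_square)
    moreover have "\<bar>u l\<bar> \<le> 2 * (K' * (1 / \<rho>) ^ l) - u l"
      using u_lt[of l] K' \<rho> by (simp add: abs_if zero_le_divide_iff) 
    ultimately show ?thesis by (meson mult_left_mono norm_ge_zero order_trans)
  qed
  define C where "C = cmod \<beta> * (2 * K' / (1 - 1 / \<rho>) + 2 * cmod \<beta> / cmod (1 - z))"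
  have upper: "(\<Sum>l<N. (u l)\<^sup>2) \<le> C" for N
  proof -
    have "(\<Sum>l<N. (u l)\<^sup>2) \<le> (\<Sum>l<N. cmod \<beta> * (2 * (K' * (1 / \<rho>) ^ l) - u l))"
      by (intro sum_mono abs_u)
    also have "\<dots> = cmod \<beta> * (2 * K' * (\<Sum>l<N. (1 / \<rho>) ^ l) - (\<Sum>l<N. u l))"
      by (simp add: sum_distrib_left sum_subtractf algebra_simps)
    also have "\<dots> \<le> C"
    proof -
      have "(\<Sum>l<N. (1 / \<rho>) ^ l) = (1 - (1 / \<rho>) ^ N) / (1 - 1 / \<rho>)"
        using \<rho> by (subst sum_gp_strict) auto
      also have "\<dots> \<le> 1 / (1 - 1 / \<rho>)" using \<rho> by (intro divide_right_mono) auto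
      finally have "2 * K' * (\<Sum>l<N. (1 / \<rho>) ^ l) \<le> 2 * K' / (1 - 1 / \<rho>)"
        using K' by (metis mult.right_neutral mult_left_mono times_divide_eq_right order_less_imp_le zero_less_mult_iff zero_less_numeral)
      moreover have "- (\<Sum>l<N. u l) \<le> 2 * cmod \<beta> / cmod (1 - z)"
      proof -
        have "(\<Sum>l<N. u l) = Re (\<Sum>l<N. \<beta> * z ^ l)" by (simp add: u_def)
        thus ?thesis using geo[OF z z1, of \<beta> N] abs_Re_le_cmod[of "\<Sum>l<N. \<beta> * z ^ l"] by linarith
      qed
      ultimately show ?thesis unfolding C_def by (intro mult_left_mono) auto
    qed
    finally show ?thesis .
  qed
  define D where "D = 2 * (cmod \<beta>)\<^sup>2 / cmod (1 - z\<^sup>2)"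
  have lower: "real N * (cmod \<beta>)\<^sup>2 - D \<le> 2 * (\<Sum>l<N. (u l)\<^sup>2)" for N
  proof -
    \<comment> \<open>Angle doubling: the square becomes a constant plus a geometric term of ratio
      \<open>z^2\<close>.\<close>
    have sq: "2 * (Re w)\<^sup>2 = (cmod w)\<^sup>2 + Re (w\<^sup>2)" for w
      by (simp add: cmod_power2 Re_power2)
    have "2 * (u l)\<^sup>2 = (cmod \<beta>)\<^sup>2 + Re (\<beta>\<^sup>2 * (z\<^sup>2) ^ l)" for l
      unfolding u_def sq by (simp add: norm_mult norm_power z power_mult_distrib flip: power_mult) (simp add: mult.commute)
    hence "2 * (\<Sum>l<N. (u l)\<^sup>2) = real N * (cmod \<beta>)\<^sup>2 + Re (\<Sum>l<N. \<beta>\<^sup>2 * (z\<^sup>2) ^ l)"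
      by (simp add: sum_distrib_left sum.distrib)
    moreover have "cmod (\<Sum>l<N. \<beta>\<^sup>2 * (z\<^sup>2) ^ l) \<le> D"
      using geo[OF _ z2, of "\<beta>\<^sup>2" N] by (simp add: D_def norm_power z)
    ultimately show ?thesis using abs_Re_le_cmod[of "\<Sum>l<N. \<beta>\<^sup>2 * (z\<^sup>2) ^ l"] by linarith
  qed
  obtain N where "real N * (cmod \<beta>)\<^sup>2 > 2 * C + D"
    using reals_Archimedean3[of "(cmod \<beta>)\<^sup>2"] \<beta> by auto
  thus False using upper[of N] lower[of N] by linarith
qed

text \<open>Starting from the representation at \<open>L\<close>, repeated multiplication produces
  one for each later exponent. Uniqueness identifies its \<open>c\<close> with the given one up to
  sign, and the residue modulo 3 settles the sign, so a bound on the family would bound the real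
  parts of a geometric sequence.\<close>

lemma no_bounded_family_of_reps:
  fixes p x y K :: int and s t L :: nat
  assumes p: "Factorial_Ring.prime p" "p mod 3 = 1" and t: "t > 0" and L: "L > 0"
    and xy: "p ^ t = x\<^sup>2 + 27 * y\<^sup>2" "\<not> p dvd x"
    and fam: "\<And>l. l \<ge> L \<Longrightarrow> \<exists>c d. c\<^sup>2 + 27 * d\<^sup>2 = 4 * p ^ (3 * (t * l + s)) \<and> c mod 3 = 1 \<and> \<not> p dvd c \<and> c < K"
  shows False
proof -
  have p2: "p > 2" "\<not> p dvd 2"
  proof -
    have "p \<noteq> 2" "p \<ge> 2" using p prime_ge_2_int[of p] by auto
    thus "p > 2" "\<not> p dvd 2" using zdvd_imp_le[of p 2] by auto
  qed
  obtain X Y0 where X: "X\<^sup>2 + 27 * Y0\<^sup>2 = p ^ (3 * t)" "\<not> p dvd X" "X mod 3 = 1"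
  proof -
    \<comment> \<open>\<open>X0\<close> and \<open>Y0\<close> are the coefficients of
      \<open>(x + y * sqrt (- 27))^3\<close>; a cube because the exponent grows by
      \<open>3 * t\<close> when \<open>l\<close> grows by one.\<close>
    define X0 where "X0 = x * (x\<^sup>2 - 81 * y\<^sup>2)"
    define Y0 where "Y0 = 3 * y * (x\<^sup>2 - 9 * y\<^sup>2)"
    have n: "X0\<^sup>2 + 27 * Y0\<^sup>2 = p ^ (3 * t)"
    proof -
      have "X0\<^sup>2 + 27 * Y0\<^sup>2 = (x\<^sup>2 + 27 * y\<^sup>2) ^ 3"
        unfolding X0_def Y0_def by (simp add: power2_eq_square power3_eq_cube algebra_simps)
      also have "\<dots> = p ^ (3 * t)"
        unfolding xy(1) [symmetric] by (simp add: power_mult [symmetric] mult.commute)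
      finally show ?thesis .
    qed
    have d: "\<not> p dvd X0"
    proof
      assume "p dvd X0"
      hence "p dvd x\<^sup>2 - 81 * y\<^sup>2" using xy(2) p(1) by (auto simp: X0_def prime_dvd_mult_iff)
      moreover have "p dvd 3 * (x\<^sup>2 + 27 * y\<^sup>2)"
        unfolding xy(1) [symmetric] using t by (simp add: dvd_mult)
      ultimately have "p dvd (x\<^sup>2 - 81 * y\<^sup>2) + 3 * (x\<^sup>2 + 27 * y\<^sup>2)" by (rule dvd_add)
      also have "(x\<^sup>2 - 81 * y\<^sup>2) + 3 * (x\<^sup>2 + 27 * y\<^sup>2) = 2 * (2 * x\<^sup>2)" by simp
      finally have "p dvd 2 * (2 * x\<^sup>2)" .
      thus False using p(1) p2 xy(2) by (meson prime_dvd_mult_iff prime_dvd_power)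
    qed
    have "(X0\<^sup>2 + 27 * Y0\<^sup>2) mod 3 = 1" unfolding n by (subst power_mod [symmetric]) (simp add: p(2))
    hence "X0\<^sup>2 mod 3 = 1" by presburger
    hence "X0 mod 3 \<noteq> 0" by (auto simp: power2_eq_square)
    hence "X0 mod 3 = 1 \<or> (- X0) mod 3 = 1" by presburger
    thus thesis
    proof
      assume "X0 mod 3 = 1"
      with n d show thesis by (rule that)
    next
      assume "(- X0) mod 3 = 1"
      moreover have "(- X0)\<^sup>2 + 27 * Y0\<^sup>2 = p ^ (3 * t)" "\<not> p dvd - X0" using n d by simp_all
      ultimately show thesis using that by blast
    qed
  qed
  \<comment> \<open>This makes the ratio \<gamma> of the geometric sequence non-real.\<close>
  have Y0: "Y0 \<noteq> 0"
  proof
    assume "Y0 = 0"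
    hence "p dvd X\<^sup>2" using X(1) t by (simp add: dvd_power)
    thus False using X(2) p(1) prime_dvd_power by blast
  qed
  obtain c0 d0 where c0: "c0\<^sup>2 + 27 * d0\<^sup>2 = 4 * p ^ (3 * (t * L + s))" "c0 mod 3 = 1" "\<not> p dvd c0"
    using fam[of L] by auto
  have e: "c0\<^sup>2 = 4 * p ^ (3 * (t * L + s)) - 27 * d0\<^sup>2" "X\<^sup>2 = p ^ (3 * t) - 27 * Y0\<^sup>2"
    using c0(1) X(1) by linarith+
  \<comment> \<open>The sign of \<open>Y\<close> selects, among \<open>X + Y * sqrt (- 27)\<close> and its conjugate, the factor by which
    repeated multiplication never makes the real part divisible by \<open>p\<close>.\<close>
  obtain Y where Y: "Y\<^sup>2 = Y0\<^sup>2" "p dvd c0 * Y - d0 * X"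
  proof -
    have "(c0 * Y0 - d0 * X) * (c0 * Y0 + d0 * X) = c0\<^sup>2 * Y0\<^sup>2 - d0\<^sup>2 * X\<^sup>2"
      by (simp add: power2_eq_square algebra_simps)
    also have "\<dots> = (4 * p ^ (3 * (t * L + s)) - 27 * d0\<^sup>2) * Y0\<^sup>2 - d0\<^sup>2 * (p ^ (3 * t) - 27 * Y0\<^sup>2)"
      unfolding e ..
    also have "\<dots> = 4 * p ^ (3 * (t * L + s)) * Y0\<^sup>2 - d0\<^sup>2 * p ^ (3 * t)"
      by (simp add: algebra_simps)
    also have "p dvd \<dots>" using t L by (intro dvd_diff dvd_mult dvd_mult2 dvd_power) auto
    finally have "p dvd c0 * Y0 - d0 * X \<or> p dvd c0 * Y0 + d0 * X"
      using p(1) prime_dvd_mult_iff by blast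
    moreover have "p dvd c0 * Y0 + d0 * X \<longleftrightarrow> p dvd c0 * (- Y0) - d0 * X"
    proof -
      have "c0 * (- Y0) - d0 * X = - (c0 * Y0 + d0 * X)" by simp
      thus ?thesis by (metis dvd_minus_iff)
    qed
    ultimately show thesis using that[of Y0] that[of "- Y0"] by auto
  qed
  have XY: "X\<^sup>2 + 27 * Y\<^sup>2 = p ^ (3 * t)" by (simp add: Y(1) X(1))
  \<comment> \<open>Multiplication of \<open>c + d * sqrt (- 27)\<close> by
    \<open>X + Y * sqrt (- 27)\<close>, kept in integer coordinates.\<close>
  define f where "f = (\<lambda>(c, d). (c * X - 27 * d * Y, d * X + c * Y))"
  define r where "r l = (f ^^ l) (c0, d0)" for l
  define c d where "c l = fst (r l)" and "d l = snd (r l)" for l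
  have rec: "c (Suc l) = c l * X - 27 * d l * Y" "d (Suc l) = d l * X + c l * Y" for l
    by (simp_all add: c_def d_def r_def f_def case_prod_beta)
  have init: "c 0 = c0" "d 0 = d0" by (simp_all add: c_def d_def r_def)
  have inv: "(c l)\<^sup>2 + 27 * (d l)\<^sup>2 = 4 * p ^ (3 * (t * (L + l) + s)) \<and> c l mod 3 = 1 \<and> \<not> p dvd c l
      \<and> p dvd c l * Y - d l * X" for l
  proof (induction l)
    case 0
    thus ?case using c0 Y by (simp add: init)
  next
    case (Suc l)
    have pXY: "p dvd X\<^sup>2 + 27 * Y\<^sup>2" using t by (simp add: XY dvd_power)
    have "(c (Suc l))\<^sup>2 + 27 * (d (Suc l))\<^sup>2 = ((c l)\<^sup>2 + 27 * (d l)\<^sup>2) * (X\<^sup>2 + 27 * Y\<^sup>2)"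
      by (simp add: rec power2_eq_square algebra_simps)
    also have "\<dots> = 4 * (p ^ (3 * (t * (L + l) + s)) * p ^ (3 * t))"
      using Suc.IH by (simp add: XY)
    also have "p ^ (3 * (t * (L + l) + s)) * p ^ (3 * t) = p ^ (3 * (t * (L + Suc l) + s))"
      by (simp add: algebra_simps flip: power_add)
    finally have 1: "(c (Suc l))\<^sup>2 + 27 * (d (Suc l))\<^sup>2 = 4 * p ^ (3 * (t * (L + Suc l) + s))" .
    have "c (Suc l) = c l * X + 3 * (- 9 * d l * Y)" by (simp add: rec)
    hence "c (Suc l) mod 3 = (c l * X) mod 3" by (simp only: mod_mult_self2)
    also have "\<dots> = ((c l mod 3) * (X mod 3)) mod 3" by (rule mod_mult_eq [symmetric])
    finally have 2: "c (Suc l) mod 3 = 1" using Suc.IH X(3) by simp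
    have "c (Suc l) * Y - d (Suc l) * X = - d l * (X\<^sup>2 + 27 * Y\<^sup>2)"
      by (simp add: rec power2_eq_square algebra_simps)
    hence 4: "p dvd c (Suc l) * Y - d (Suc l) * X" using pXY by (metis dvd_mult)
    have 3: "\<not> p dvd c (Suc l)"
    proof
      assume "p dvd c (Suc l)"
      \<comment> \<open>In this combination everything but \<open>2 * c l * X^2\<close> cancels, and
        \<open>p\<close> divides none of these factors.\<close>
      hence "p dvd X * c (Suc l) + c l * (X\<^sup>2 + 27 * Y\<^sup>2) - 27 * Y * (c l * Y - d l * X)"
        using pXY Suc.IH by (intro dvd_diff dvd_add) (auto simp: dvd_mult)
      also have "X * c (Suc l) + c l * (X\<^sup>2 + 27 * Y\<^sup>2) - 27 * Y * (c l * Y - d l * X) = 2 * (c l * X\<^sup>2)"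
        by (simp add: rec power2_eq_square algebra_simps)
      finally show False using p(1) p2 X(2) Suc.IH by (meson prime_dvd_mult_iff prime_dvd_power)
    qed
    show ?case using 1 2 3 4 by blast
  qed
  have bound: "c l < K" for l
  proof -
    obtain c' d' where c': "c'\<^sup>2 + 27 * d'\<^sup>2 = 4 * p ^ (3 * (t * (L + l) + s))" "c' mod 3 = 1"
      "\<not> p dvd c'" "c' < K"
      using fam[of "L + l"] by auto
    have "(c l)\<^sup>2 = c'\<^sup>2"
      using inv[of l] c' p2 t L by (intro quadratic_form_rep_unique[OF p(1), of "3 * (t * (L + l) + s)" _ "d l" _ d']) auto
    hence "c l = c' \<or> c l = - c'" by (simp add: power2_eq_iff)
    moreover have "c l mod 3 = 1" using inv by blast
    ultimately have "c l = c'" using c'(2) by presburger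
    thus ?thesis using c'(4) by simp
  qed
  define \<gamma> where "\<gamma> = Complex (of_int X) (sqrt 27 * of_int Y)"
  define \<beta> where "\<beta> = Complex (of_int c0) (sqrt 27 * of_int d0)"
  have s27: "sqrt 27 * (sqrt 27 * a) = 27 * a" for a :: real
    by (simp flip: mult.assoc)
  have pow: "\<beta> * \<gamma> ^ l = Complex (of_int (c l)) (sqrt 27 * of_int (d l))" for l
  proof (induction l)
    case 0
    thus ?case by (simp add: \<beta>_def init)
  next
    case (Suc l)
    have "\<beta> * \<gamma> ^ Suc l = Complex (of_int (c l)) (sqrt 27 * of_int (d l)) * \<gamma>"
      using Suc.IH by (simp add: mult_ac)
    also have "\<dots> = Complex (of_int (c (Suc l))) (sqrt 27 * of_int (d (Suc l)))"
      by (simp add: \<gamma>_def rec complex_mult algebra_simps s27)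
    finally show ?case .
  qed
  have "\<exists>l. Re (\<beta> * \<gamma> ^ l) \<ge> of_int K"
  proof (rule exists_large_Re_mult_power)
    show "\<beta> \<noteq> 0" using c0(3) by (auto simp: \<beta>_def complex_eq_iff)
    show "Im \<gamma> \<noteq> 0" using Y(1) Y0 by (auto simp: \<gamma>_def)
    have "(cmod \<gamma>)\<^sup>2 = of_int (X\<^sup>2 + 27 * Y\<^sup>2)"
      by (simp add: \<gamma>_def cmod_power2 power_mult_distrib)
    moreover have "X\<^sup>2 + 27 * Y\<^sup>2 > 1" unfolding XY using p2 t by (intro one_less_power) auto
    ultimately have "(cmod \<gamma>)\<^sup>2 > 1\<^sup>2" by (metis of_int_less_iff of_int_1 power_one)
    thus "cmod \<gamma> > 1" using power_less_imp_less_base norm_ge_zero by blast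
  qed
  then obtain l where "of_int K \<le> (of_int (c l) :: real)" unfolding pow by auto
  thus False using bound[of l] by linarith
qed

section \<open>Central binomial coefficients modulo a prime\<close>

text \<open>Since \<open>r < p\<close>, the multiples of \<open>p\<close> up to
  \<open>p * m + r\<close> are the first \<open>m\<close> ones; their product is
  \<open>p ^ m * fact m\<close>, and the remaining factors are prime to \<open>p\<close>.\<close>

lemma fact_mult_add_decomp:
  fixes p :: nat
  assumes "Factorial_Ring.prime p" "r < p"
  shows "\<exists>u. \<not> p dvd u \<and> fact (p * m + r) = p ^ m * fact m * u"
  using assms(2)
proof (induction m arbitrary: r)
  case 0
  thus ?case using assms(1) by (intro exI[of _ "fact r"]) (simp add: prime_dvd_fact_iff)
next
  case (Suc m)
  note step = Suc
  from Suc.prems show ?case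
  proof (induction r)
    case 0
    have p: "p > 0" using assms(1) prime_gt_0_nat by blast
    obtain u where u: "\<not> p dvd u" "fact (p * m + (p - 1)) = p ^ m * fact m * u"
      using step(1)[of "p - 1"] p by auto
    have "p * Suc m + 0 = Suc (p * m + (p - 1))" using p by simp
    hence "fact (p * Suc m + 0) = p * Suc m * (p ^ m * fact m * u)"
      using u(2) by (simp del: mult_Suc_right)
    thus ?case using u(1) by (intro exI[of _ u]) (simp add: algebra_simps)
  next
    case (Suc r)
    then obtain u where u: "\<not> p dvd u" "fact (p * Suc m + r) = p ^ Suc m * fact (Suc m) * u"
      by auto
    have "\<not> p dvd p * Suc m + Suc r"
      using Suc.prems by (metis dvd_add_right_iff dvd_imp_le dvd_triv_left not_le zero_less_Suc)
    hence "\<not> p dvd (p * Suc m + Suc r) * u" using u(1) assms(1) prime_dvd_multD by blast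
    moreover have "fact (p * Suc m + Suc r) = p ^ Suc m * fact (Suc m) * ((p * Suc m + Suc r) * u)"
      using u(2) by (simp only: add_Suc_right fact_Suc of_nat_id mult_ac)
    ultimately show ?case by blast
  qed
qed

text \<open>In base \<open>p\<close> every digit of \<open>n\<close> equals \<open>e\<close>, and
  \<open>2 * e < p\<close>, so doubling \<open>n\<close> causes no carry. The induction strips the
  last digit: \<open>n = p * m + e\<close> with \<open>m\<close> of the same shape for
  \<open>N - 1\<close>.\<close>

lemma prime_not_dvd_central_binomial:
  fixes p e n N :: nat
  assumes p: "Factorial_Ring.prime p" "p = 3 * e + 1" and n: "3 * n + 1 = p ^ N"
  shows "\<not> p dvd ((2 * n) choose n)"
  using n
proof (induction N arbitrary: n)
  case 0
  thus ?case using p(1) by (auto simp: prime_nat_iff)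
next
  case (Suc N)
  define m where "m = (p ^ N - 1) div 3"
  have m: "3 * m + 1 = p ^ N"
  proof -
    have "p ^ N mod 3 = 1"
    proof -
      have "p mod 3 = 1" using p(2) by presburger
      thus ?thesis by (subst power_mod [symmetric]) simp
    qed
    thus ?thesis unfolding m_def by presburger
  qed
  have nm: "n = p * m + e"
  proof -
    have "3 * n + 1 = p * (3 * m + 1)" using Suc.prems m by simp
    also have "\<dots> = 3 * (p * m) + p" by (simp add: algebra_simps)
    finally show ?thesis using p(2) by simp
  qed
  obtain u where u: "\<not> p dvd u" "fact (p * m + e) = p ^ m * fact m * u"
    using fact_mult_add_decomp[OF p(1), of e m] p(2) by auto
  obtain v where v: "\<not> p dvd v" "fact (p * (2 * m) + 2 * e) = p ^ (2 * m) * fact (2 * m) * v"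
    using fact_mult_add_decomp[OF p(1), of "2 * e" "2 * m"] p(1,2) prime_gt_1_nat[OF p(1)] by auto
  have binom: "fact (2 * k) = fact k * fact k * ((2 * k) choose k)" for k :: nat
    using binomial_fact_lemma[of k "2 * k"] by (simp add: mult_2)
  have "(p ^ m * fact m)\<^sup>2 * (u\<^sup>2 * ((2 * n) choose n)) = fact n * fact n * ((2 * n) choose n)"
    unfolding nm u(2) by (simp add: power2_eq_square mult_ac)
  also have "\<dots> = fact (p * (2 * m) + 2 * e)"
    unfolding binom[symmetric] by (simp add: nm algebra_simps)
  also have "\<dots> = (p ^ m * fact m)\<^sup>2 * (((2 * m) choose m) * v)"
    unfolding v(2) unfolding binom[of m] unfolding mult_2[of m] power_add by (simp add: power2_eq_square mult_ac)
  finally have "u\<^sup>2 * ((2 * n) choose n) = ((2 * m) choose m) * v"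
    using p(2) by simp
  moreover have "\<not> p dvd ((2 * m) choose m) * v"
    using Suc.IH[OF m] v(1) p(1) prime_dvd_multD by blast
  ultimately show ?case by (metis dvd_mult)
qed

section \<open>Spectra from resolutions of the identity\<close>

lemma upper_triangular_mult:
  fixes A B :: "'a :: semiring_0 mat"
  assumes A: "A \<in> carrier_mat n n" "upper_triangular A" and B: "B \<in> carrier_mat n n" "upper_triangular B"
  shows "upper_triangular (A * B)" and "i < n \<Longrightarrow> (A * B) $$ (i, i) = A $$ (i, i) * B $$ (i, i)"
proof -
  have entry: "(A * B) $$ (i, j) = (\<Sum>k<n. A $$ (i, k) * B $$ (k, j))" if "i < n" "j < n" for i j
    using that A B by (simp add: scalar_prod_def lessThan_atLeast0)
  have A0: "A $$ (i, k) = 0" if "k < i" "i < n" for i k using A that by auto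
  have B0: "B $$ (k, j) = 0" if "j < k" "k < n" for j k using B that by auto
  show "upper_triangular (A * B)"
  proof (rule upper_triangularI)
    fix i j assume ij: "j < i" "i < dim_row (A * B)"
    have "A $$ (i, k) * B $$ (k, j) = 0" if "k < n" for k
      using A0[of k i] B0[of j k] that ij A by (cases "k < i") auto
    thus "(A * B) $$ (i, j) = 0" using ij A by (subst entry) auto
  qed
  assume i: "i < n"
  have "(\<Sum>k<n. A $$ (i, k) * B $$ (k, i)) = (\<Sum>k\<in>{i}. A $$ (i, k) * B $$ (k, i))"
  proof (rule sum.mono_neutral_right)
    show "\<forall>k\<in>{..<n} - {i}. A $$ (i, k) * B $$ (k, i) = 0"
      using A0[of _ i] B0[of i] i by (metis DiffD1 DiffD2 insertI1 lessThan_iff linorder_neqE_nat mult_zero_left mult_zero_right)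
  qed (use i in auto)
  thus "(A * B) $$ (i, i) = A $$ (i, i) * B $$ (i, i)" using i by (subst entry) auto
qed

text \<open>The polynomial with root list \<open>rs\<close>, evaluated at \<open>A\<close>. As a
  product of linear factors it passes through triangular form, conjugation and eigenvectors by
  induction on the list.\<close>

definition shift_prod :: "'a :: comm_ring_1 mat \<Rightarrow> 'a list \<Rightarrow> 'a mat" where
  "shift_prod A rs = foldr (\<lambda>s M. (A - s \<cdot>\<^sub>m 1\<^sub>m (dim_row A)) * M) rs (1\<^sub>m (dim_row A))"

lemma shift_prod_simps:
  assumes "A \<in> carrier_mat n n"
  shows "shift_prod A [] = 1\<^sub>m n" and "shift_prod A (s # rs) = (A - s \<cdot>\<^sub>m 1\<^sub>m n) * shift_prod A rs"
  using assms by (simp_all add: shift_prod_def)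

lemma shift_prod_carrier:
  assumes "A \<in> carrier_mat n n"
  shows "shift_prod A rs \<in> carrier_mat n n"
proof (induction rs)
  case Nil
  show ?case using assms by (simp add: shift_prod_simps)
next
  case (Cons s rs)
  have "A - s \<cdot>\<^sub>m 1\<^sub>m n \<in> carrier_mat n n" using assms by auto
  with Cons show ?case using assms by (simp add: shift_prod_simps)
qed

lemma shift_prod_upper_triangular:
  assumes A: "A \<in> carrier_mat n n" "upper_triangular A"
  shows "upper_triangular (shift_prod A rs) \<and> (\<forall>i<n. shift_prod A rs $$ (i, i) = (\<Prod>s\<leftarrow>rs. A $$ (i, i) - s))"
proof (induction rs)
  case Nil
  show ?case using A by (simp add: shift_prod_simps)
next
  case (Cons s rs)
  have ut: "upper_triangular (A - s \<cdot>\<^sub>m 1\<^sub>m n)" using A by (intro upper_triangularI) auto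
  have car: "A - s \<cdot>\<^sub>m 1\<^sub>m n \<in> carrier_mat n n" using A by auto
  note mult = upper_triangular_mult[OF car ut shift_prod_carrier[OF A(1)]]
  show ?case using Cons A mult by (auto simp: shift_prod_simps)
qed

lemma shift_prod_eigen:
  assumes A: "A \<in> carrier_mat n n" and E: "E \<in> carrier_mat n n" "A * E = r \<cdot>\<^sub>m E"
  shows "shift_prod A rs * E = (\<Prod>s\<leftarrow>rs. r - s) \<cdot>\<^sub>m E"
proof (induction rs)
  case Nil
  show ?case using A E by (intro eq_matI) (auto simp: shift_prod_simps)
next
  case (Cons s rs)
  let ?S = "A - s \<cdot>\<^sub>m 1\<^sub>m n" and ?c = "\<Prod>s\<leftarrow>rs. r - s"
  have S: "?S \<in> carrier_mat n n" using A by auto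
  have "?S * E = A * E - s \<cdot>\<^sub>m 1\<^sub>m n * E" using A E(1) by (intro minus_mult_distrib_mat) auto
  also have "\<dots> = (r - s) \<cdot>\<^sub>m E"
    using E by (intro eq_matI) (auto simp: algebra_simps)
  finally have SE: "?S * E = (r - s) \<cdot>\<^sub>m E" .
  have "shift_prod A (s # rs) * E = ?S * (shift_prod A rs * E)"
    unfolding shift_prod_simps(2)[OF A] by (rule assoc_mult_mat[OF S shift_prod_carrier[OF A] E(1)])
  also have "\<dots> = ?c \<cdot>\<^sub>m (?S * E)" unfolding Cons by (rule mult_smult_distrib[OF S E(1)])
  also have "\<dots> = (\<Prod>s\<leftarrow>s # rs. r - s) \<cdot>\<^sub>m E"
    unfolding SE by (intro eq_matI) (auto simp: mult_ac)
  finally show ?case .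
qed

lemma shift_prod_similar:
  assumes sim: "similar_mat_wit A T P Q" and A: "A \<in> carrier_mat n n"
  shows "shift_prod A rs = P * shift_prod T rs * Q"
proof (induction rs)
  note w = similar_mat_witD2[OF A sim]
  case Nil
  show ?case unfolding shift_prod_simps(1)[OF A] shift_prod_simps(1)[OF w(5)] using w by simp
next
  note w = similar_mat_witD2[OF A sim]
  case (Cons s rs)
  let ?S = "T - s \<cdot>\<^sub>m 1\<^sub>m n" and ?M = "shift_prod T rs"
  have S: "?S \<in> carrier_mat n n" using w by auto
  have M: "?M \<in> carrier_mat n n" by (rule shift_prod_carrier[OF w(5)])
  have PS: "P * ?S = P * T - s \<cdot>\<^sub>m P"
    using w by (subst mult_minus_distrib_mat[of _ n n _ n]) (auto simp: mult_smult_distrib[of _ n n])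
  have "P * ?S * Q = P * T * Q - s \<cdot>\<^sub>m P * Q"
    unfolding PS using w by (intro minus_mult_distrib_mat) auto
  also have "\<dots> = A - s \<cdot>\<^sub>m 1\<^sub>m n"
    using w by (simp add: mult_smult_assoc_mat[of _ n n])
  finally have S': "A - s \<cdot>\<^sub>m 1\<^sub>m n = P * ?S * Q" ..
  have "shift_prod A (s # rs) = P * ?S * Q * (P * ?M * Q)"
    unfolding shift_prod_simps(2)[OF A] Cons S' ..
  also have "\<dots> = P * ?S * (Q * (P * (?M * Q)))"
    using w S M by (simp add: assoc_mult_mat[of _ n n _ n _ n])
  also have "Q * (P * (?M * Q)) = (Q * P) * (?M * Q)"
    using w S M by (intro assoc_mult_mat[symmetric]) auto
  also have "\<dots> = ?M * Q" using w S M by simp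
  also have "P * ?S * (?M * Q) = P * (?S * ?M) * Q"
    using w S M by (simp add: assoc_mult_mat[of _ n n _ n _ n])
  finally show ?case by (simp add: shift_prod_simps(2)[OF w(5)])
qed

text \<open>A resolution of the identity into eigenspace projections determines the spectrum with
  multiplicities: the number of eigenvalues equal to \<open>r\<close> is read off the trace of the product of the
  \<open>B - s\<close> over the other eigenvalues \<open>s\<close>. The \<open>r i\<close> need not be distinct.\<close>

lemma proots_char_poly_resolution_of_identity:
  fixes B :: "complex mat" and E :: "'i \<Rightarrow> complex mat"
  assumes I: "finite I" and B: "B \<in> carrier_mat n n"
    and E: "\<And>i. i \<in> I \<Longrightarrow> E i \<in> carrier_mat n n" "\<And>i. i \<in> I \<Longrightarrow> B * E i = r i \<cdot>\<^sub>m E i"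
    and one: "\<And>a b. a < n \<Longrightarrow> b < n \<Longrightarrow> (\<Sum>i\<in>I. E i $$ (a, b)) = (if a = b then 1 else 0)"
    and tr: "\<And>i. i \<in> I \<Longrightarrow> (\<Sum>a<n. E i $$ (a, a)) = of_nat (m i)"
  shows "proots (char_poly B) = (\<Sum>i\<in>I. replicate_mset (m i) (r i))"
proof -
  obtain es where es: "char_poly B = (\<Prod>a\<leftarrow>es. [:- a, 1:])" "length es = n"
    using char_poly_factorized[OF B] by blast
  obtain T P Q where schur: "schur_decomposition B es = (T, P, Q)"
    by (cases "schur_decomposition B es") auto
  have sim: "similar_mat_wit B T P Q" and ut: "upper_triangular T" and diag: "diag_mat T = es"
    using schur_decomposition[OF B es(1) schur] by auto
  note w = similar_mat_witD2[OF B sim]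
  have esn: "es = map (\<lambda>a. T $$ (a, a)) [0..<n]" using diag w(5) by (simp add: diag_mat_def)
  have "proots (\<Prod>a\<leftarrow>as. [:- a, 1:]) = mset as" for as :: "complex list"
  proof (induction as)
    case (Cons a as)
    have "(\<Prod>a\<leftarrow>as. [:- a, 1:]) \<noteq> 0" by (auto simp: prod_list_zero_iff)
    hence "proots ([:- a, 1:] * (\<Prod>a\<leftarrow>as. [:- a, 1:])) = proots [:- a, 1:] + proots (\<Prod>a\<leftarrow>as. [:- a, 1:])"
      by (intro proots_mult) simp_all
    also have "\<dots> = mset (a # as)" unfolding Cons by simp
    finally show ?case by (simp only: list.map prod_list.Cons)
  qed simp
  hence proots: "proots (char_poly B) = mset es" by (simp add: es(1))
  \<comment> \<open>The polynomial in \<open>B\<close> is multiplied by the identity, written as the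
    sum of the \<open>E i\<close>.\<close>
  have expand: "shift_prod B rs $$ (a, b) = (\<Sum>i\<in>I. (\<Prod>s\<leftarrow>rs. r i - s) * E i $$ (a, b))"
    if "a < n" "b < n" for rs a b
  proof -
    let ?X = "shift_prod B rs"
    have X: "?X \<in> carrier_mat n n" by (rule shift_prod_carrier[OF B])
    have "(\<Sum>i\<in>I. (\<Prod>s\<leftarrow>rs. r i - s) * E i $$ (a, b)) = (\<Sum>i\<in>I. (?X * E i) $$ (a, b))"
    proof (intro sum.cong refl)
      fix i assume i: "i \<in> I"
      have "E i \<in> carrier_mat n n" by (rule E(1)[OF i])
      thus "(\<Prod>s\<leftarrow>rs. r i - s) * E i $$ (a, b) = (?X * E i) $$ (a, b)"
        unfolding shift_prod_eigen[OF B E[OF i]] using that by simp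
    qed
    also have "\<dots> = (\<Sum>i\<in>I. \<Sum>k<n. ?X $$ (a, k) * E i $$ (k, b))"
      using E(1) X that by (intro sum.cong) (auto simp: scalar_prod_def lessThan_atLeast0 dest!: E(1))
    also have "\<dots> = (\<Sum>k<n. ?X $$ (a, k) * (\<Sum>i\<in>I. E i $$ (k, b)))"
      by (subst sum.swap) (simp add: sum_distrib_left)
    also have "\<dots> = (\<Sum>k<n. if k = b then ?X $$ (a, k) else 0)"
      using that by (intro sum.cong) (auto simp: one)
    also have "\<dots> = ?X $$ (a, b)" using that by simp
    finally show ?thesis ..
  qed
  have diagT: "shift_prod T rs $$ (a, a) = (\<Prod>s\<leftarrow>rs. T $$ (a, a) - s)" if "a < n" for rs a
    using shift_prod_upper_triangular[OF w(5) ut] that by blast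
  have trace_comm: "(\<Sum>a<n. (X * Y) $$ (a, a)) = (\<Sum>a<n. (Y * X) $$ (a, a))"
    if "X \<in> carrier_mat n n" "Y \<in> carrier_mat n n" for X Y :: "complex mat"
  proof -
    have "(\<Sum>a<n. (X * Y) $$ (a, a)) = (\<Sum>a<n. \<Sum>k<n. X $$ (a, k) * Y $$ (k, a))"
      using that by (intro sum.cong) (auto simp: scalar_prod_def lessThan_atLeast0)
    also have "\<dots> = (\<Sum>k<n. \<Sum>a<n. Y $$ (k, a) * X $$ (a, k))"
      by (subst sum.swap) (simp add: mult.commute)
    also have "\<dots> = (\<Sum>a<n. (Y * X) $$ (a, a))"
      using that by (intro sum.cong) (auto simp: scalar_prod_def lessThan_atLeast0)
    finally show ?thesis .
  qed
  \<comment> \<open>The trace of the polynomial in \<open>B\<close> is computed twice: from the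
    Schur form and from the resolution.\<close>
  have trace: "(\<Sum>e\<leftarrow>es. \<Prod>s\<leftarrow>rs. e - s) = (\<Sum>i\<in>I. (\<Prod>s\<leftarrow>rs. r i - s) * of_nat (m i))" for rs
  proof -
    have M: "shift_prod T rs \<in> carrier_mat n n" by (rule shift_prod_carrier[OF w(5)])
    have QP: "Q * (P * shift_prod T rs) = shift_prod T rs"
    proof -
      have "Q * (P * shift_prod T rs) = Q * P * shift_prod T rs"
        using w M by (intro assoc_mult_mat[symmetric]) auto
      thus ?thesis unfolding w(2) using M by simp
    qed
    have "(\<Sum>e\<leftarrow>es. \<Prod>s\<leftarrow>rs. e - s) = (\<Sum>a<n. shift_prod T rs $$ (a, a))"
      unfolding esn by (simp add: o_def sum_list_sum_nth lessThan_atLeast0 diagT)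
    also have "\<dots> = (\<Sum>a<n. (Q * (P * shift_prod T rs)) $$ (a, a))" by (simp only: QP)
    also have "\<dots> = (\<Sum>a<n. shift_prod B rs $$ (a, a))"
      unfolding shift_prod_similar[OF sim B] using w M by (intro trace_comm) auto
    also have "\<dots> = (\<Sum>a<n. \<Sum>i\<in>I. (\<Prod>s\<leftarrow>rs. r i - s) * E i $$ (a, a))"
      by (intro sum.cong) (auto simp: expand)
    also have "\<dots> = (\<Sum>i\<in>I. (\<Prod>s\<leftarrow>rs. r i - s) * of_nat (m i))"
      by (subst sum.swap) (simp add: tr flip: sum_distrib_left)
    finally show ?thesis .
  qed
  have root: "e \<in> r ` I" if e: "e \<in> set es" for e
  proof -
    \<comment> \<open>With all the \<open>r i\<close> as roots the polynomial annihilates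
      \<open>B\<close>, hence also every diagonal entry of \<open>T\<close>.\<close>
    obtain rs where rs: "set rs = r ` I" using finite_list[of "r ` I"] I by auto
    have zero: "shift_prod B rs = 0\<^sub>m n n"
    proof (rule eq_matI)
      fix a b assume "a < dim_row (0\<^sub>m n n :: complex mat)" "b < dim_col (0\<^sub>m n n :: complex mat)"
      moreover have "(\<Prod>s\<leftarrow>rs. r i - s) = 0" if "i \<in> I" for i
        using rs that by (auto simp: prod_list_zero_iff)
      ultimately show "shift_prod B rs $$ (a, b) = 0\<^sub>m n n $$ (a, b)" by (simp add: expand)
    qed (use shift_prod_carrier[OF B, of rs] in auto)
    have "shift_prod T rs = Q * shift_prod B rs * P"
      by (rule shift_prod_similar[OF similar_mat_wit_sym[OF sim] w(5)])
    hence "shift_prod T rs = 0\<^sub>m n n" unfolding zero using w by simp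
    moreover obtain a where "a < n" "e = T $$ (a, a)" using e unfolding esn by auto
    ultimately have "(\<Prod>s\<leftarrow>rs. e - s) = 0" using diagT[of a rs] by simp
    thus ?thesis using rs by (auto simp: prod_list_zero_iff)
  qed
  have count: "count (mset es) x = (\<Sum>i\<in>I. if r i = x then m i else 0)" for x
  proof -
    \<comment> \<open>Now the polynomial vanishes at all eigenvalues except possibly
      \<open>x\<close>, where its value \<open>D\<close> is nonzero, so the trace counts
      \<open>x\<close>.\<close>
    obtain rs where rs: "set rs = r ` I - {x}" using finite_list[of "r ` I - {x}"] I by blast
    define D where "D = (\<Prod>s\<leftarrow>rs. x - s)"
    have D: "D \<noteq> 0" using rs by (auto simp: D_def prod_list_zero_iff)
    have val: "(\<Prod>s\<leftarrow>rs. e - s) = (if e = x then D else 0)" if "e \<in> r ` I" for e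
      using that rs by (auto simp: D_def prod_list_zero_iff)
    have "(\<Sum>e\<leftarrow>es. \<Prod>s\<leftarrow>rs. e - s) = (\<Sum>e\<leftarrow>es. if e = x then D else 0)"
      using val root by (intro arg_cong[of _ _ sum_list] map_cong) auto
    also have "\<dots> = of_nat (count (mset es) x) * D"
      by (induction es) (auto simp: algebra_simps)
    finally have "of_nat (count (mset es) x) * D = (\<Sum>i\<in>I. (if r i = x then D else 0) * of_nat (m i))"
      unfolding trace by (simp add: val)
    also have "\<dots> = of_nat (\<Sum>i\<in>I. if r i = x then m i else 0) * D"
      unfolding of_nat_sum sum_distrib_right by (intro sum.cong) auto
    finally show ?thesis using D by (metis mult_right_cancel of_nat_eq_iff)
  qed
  have "mset es = (\<Sum>i\<in>I. replicate_mset (m i) (r i))"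
  proof (rule multiset_eqI)
    fix x
    show "count (mset es) x = count (\<Sum>i\<in>I. replicate_mset (m i) (r i)) x"
      unfolding count count_sum by (intro sum.cong) auto
  qed
  thus ?thesis by (simp add: proots)
qed

section \<open>The cubic character and its Jacobi sum\<close>

text \<open>Without fixed points each orbit has exactly three elements; the induction removes one
  orbit at a time.\<close>

lemma three_dvd_card_of_free_action:
  assumes "finite S" and "\<And>x. x \<in> S \<Longrightarrow> f x \<in> S" and "\<And>x. x \<in> S \<Longrightarrow> f (f (f x)) = x"
    and "\<And>x. x \<in> S \<Longrightarrow> f x \<noteq> x"
  shows "3 dvd card S"
  using assms
proof (induction S rule: finite_psubset_induct)
  case (psubset S)
  show ?case
  proof (cases "S = {}")
    case False
    then obtain x where x: "x \<in> S" by blast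
    define T where "T = {x, f x, f (f x)}"
    have T: "T \<subseteq> S" using x psubset.prems(1) by (auto simp: T_def)
    have "f (f x) \<noteq> x" using psubset.prems(2,3)[OF x] by metis
    moreover have "f (f x) \<noteq> f x" "f x \<noteq> x" using psubset.prems x by auto
    ultimately have card_T: "card T = 3" by (auto simp: T_def)
    have "3 dvd card (S - T)"
    proof (rule psubset.IH)
      show "S - T \<subset> S" using x by (auto simp: T_def)
      show "f y \<in> S - T" if y: "y \<in> S - T" for y
      proof -
        have "f y \<in> S" using y psubset.prems(1) by blast
        moreover have "f y \<notin> T"
        proof
          assume "f y \<in> T"
          hence "f (f (f y)) \<in> T" using psubset.prems(2)[OF x] by (auto simp: T_def)
          thus False using y psubset.prems(2) by auto
        qed
        ultimately show ?thesis by blast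
      qed
    qed (use psubset.prems in auto)
    moreover have "card S = card (S - T) + card T"
      using T psubset.hyps by (metis card_Diff_subset card_mono finite_subset le_add_diff_inverse2)
    ultimately show ?thesis using card_T by simp
  qed simp
qed

section \<open>Powers of a primitive cube root of unity\<close>

definition \<omega> :: complex where "\<omega> = Complex (- 1 / 2) (sqrt 3 / 2)"

lemma omega_sq: "\<omega>\<^sup>2 = cnj \<omega>"
  by (simp add: \<omega>_def complex_eq_iff Re_power2 Im_power2 power_divide)

lemma omega_norm: "\<omega> * cnj \<omega> = 1"
  by (simp add: \<omega>_def complex_eq_iff)

lemma omega_cube: "\<omega> ^ 3 = 1"
  using omega_norm omega_sq by (simp add: power3_eq_cube power2_eq_square mult.commute)

lemma omega_power_cube: "(\<omega> ^ k) ^ 3 = 1"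
proof -
  have "(\<omega> ^ k) ^ 3 = (\<omega> ^ 3) ^ k" by (simp only: power_mult [symmetric] mult.commute)
  thus ?thesis by (simp add: omega_cube)
qed

lemma omega_sum: "1 + \<omega> + \<omega>\<^sup>2 = 0"
  unfolding omega_sq by (simp add: \<omega>_def complex_eq_iff)

lemma omega_power_mod: "\<omega> ^ (i mod 3) = \<omega> ^ i"
proof -
  have "\<omega> ^ i = \<omega> ^ (3 * (i div 3) + i mod 3)" by simp
  also have "\<dots> = \<omega> ^ (i mod 3)" unfolding power_add power_mult omega_cube by simp
  finally show ?thesis ..
qed

lemma omega_power_eq_iff: "\<omega> ^ i = \<omega> ^ j \<longleftrightarrow> i mod 3 = j mod 3"
proof
  assume "\<omega> ^ i = \<omega> ^ j"
  hence "\<omega> ^ (i mod 3) = \<omega> ^ (j mod 3)" by (simp add: omega_power_mod)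
  moreover have "k \<in> {0, 1, 2}" if "k = l mod 3" for k l :: nat using that by auto
  hence "i mod 3 \<in> {0, 1, 2}" "j mod 3 \<in> {0, 1, 2}" by blast+
  moreover have "\<omega> \<noteq> 1" "\<omega>\<^sup>2 \<noteq> 1" "\<omega>\<^sup>2 \<noteq> \<omega>"
    unfolding omega_sq by (simp_all add: \<omega>_def complex_eq_iff)
  ultimately show "i mod 3 = j mod 3" by (auto dest: sym)
next
  assume "i mod 3 = j mod 3"
  thus "\<omega> ^ i = \<omega> ^ j" by (metis omega_power_mod)
qed

lemma omega_power_eq_1_iff: "\<omega> ^ i = 1 \<longleftrightarrow> 3 dvd i"
  using omega_power_eq_iff[of i 0] by (simp add: dvd_eq_mod_eq_0)

lemma cnj_omega_power: "cnj (\<omega> ^ i) = (\<omega> ^ i)\<^sup>2"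
proof -
  have "(\<omega> ^ i)\<^sup>2 = (\<omega>\<^sup>2) ^ i" by (simp only: power_mult [symmetric] mult.commute)
  thus ?thesis by (simp add: omega_sq)
qed

locale cubic_field = field R for R :: "('a, 'b) ring_scheme" (structure) +
  fixes g :: 'a and n :: nat
  assumes finite_carrier: "finite (carrier R)"
    and gen: "g \<in> carrier R" "carrier R - {\<zero>} = {g [^] i | i :: nat. True}"
    and card_carrier: "card (carrier R) = 3 * n + 1"
begin

lemma n_pos: "n > 0"
proof (rule ccontr)
  assume "\<not> n > 0"
  hence "card (carrier R) = 1" using card_carrier by simp
  moreover have "card {\<zero>, \<one>} \<le> card (carrier R)" using finite_carrier by (intro card_mono) auto
  ultimately show False by simp
qed

lemma nonzero_obtain_power:
  assumes "x \<in> carrier R" "x \<noteq> \<zero>"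
  obtains i :: nat where "x = g [^] i"
proof -
  have "x \<in> {g [^] i | i :: nat. True}" using assms unfolding gen(2) [symmetric] by simp
  thus ?thesis using that by blast
qed

lemma gen_power [simp]: "g [^] (i :: nat) \<in> carrier R" "g [^] (i :: nat) \<noteq> \<zero>"
proof -
  have "g [^] i \<in> {g [^] i | i :: nat. True}" by blast
  hence "g [^] i \<in> carrier R - {\<zero>}" unfolding gen(2) .
  thus "g [^] i \<in> carrier R" "g [^] i \<noteq> \<zero>" by auto
qed

text \<open>The powers of \<open>g\<close> exhaust the \<open>3 * n\<close> nonzero elements, so its
  order is at least \<open>3 * n\<close>; Lagrange gives the converse bound.\<close>

lemma gen_power_eq_one_iff: "g [^] (i :: nat) = \<one> \<longleftrightarrow> 3 * n dvd i"
proof -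
  have fin: "finite (carrier (mult_of R))" using finite_carrier by (rule finite_mult_of)
  interpret G: group "mult_of R" rewrites
      "([^]\<^bsub>mult_of R\<^esub>) = (([^]) :: _ \<Rightarrow> nat \<Rightarrow> _)" and "\<one>\<^bsub>mult_of R\<^esub> = \<one>"
    by (rule field_mult_group) (simp_all add: fun_eq_iff nat_pow_def)
  have g: "g \<in> carrier (mult_of R)" using gen_power[of 1] gen(1) by simp
  have ord: "order (mult_of R) = 3 * n"
    using order_mult_of[OF finite_carrier] by (simp add: order_def card_carrier)
  have "3 * n = card (carrier R - {\<zero>})" using card_carrier finite_carrier by simp
  also have "\<dots> = card {g [^] i | i :: nat. i \<in> UNIV}" by (simp add: gen(2))
  also have "\<dots> = card {g [^] i | i :: nat. i \<in> {0..G.ord g - 1}}" 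
    using G.ord_elems[OF fin g] by simp
  also have "\<dots> = card ((\<lambda>i :: nat. g [^] i) ` {0..G.ord g - 1})" by (intro arg_cong[of _ _ card]) auto
  also have "\<dots> \<le> G.ord g"
    using card_image_le[of "{0..G.ord g - 1}" "\<lambda>i :: nat. g [^] i"] G.ord_ge_1[OF fin g] by simp
  finally have "3 * n \<le> G.ord g" .
  moreover have "G.ord g dvd 3 * n" using G.ord_dvd_group_order[OF g] by (simp add: ord)
  ultimately have "G.ord g = 3 * n" using n_pos by (simp add: dvd_imp_le le_antisym)
  thus ?thesis using G.pow_eq_id[OF g] by simp
qed

lemma gen_power_eqD:
  assumes "g [^] (i :: nat) = g [^] (j :: nat)"
  shows "i mod 3 = j mod 3"
proof -
  have *: "i mod 3 = j mod 3" if "g [^] i = g [^] j" "i \<le> j" for i j :: nat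
  proof -
    have "g [^] i \<otimes> g [^] (j - i) = g [^] j" using that(2) gen(1) by (simp add: nat_pow_mult)
    hence "g [^] i \<otimes> \<one> = g [^] i \<otimes> g [^] (j - i)" using that(1) by simp
    hence "g [^] (j - i) = \<one>" by (metis gen_power m_lcancel one_closed)
    hence "3 * n dvd j - i" by (simp add: gen_power_eq_one_iff)
    hence "3 dvd j - i" by (rule dvd_mult_left)
    thus ?thesis using that(2) by (metis mod_eq_dvd_iff_nat)
  qed
  show ?thesis
  proof (cases "i \<le> j")
    case True
    thus ?thesis by (rule *[OF assms])
  next
    case False
    thus ?thesis using *[OF assms [symmetric]] by simp
  qed
qed

text \<open>The discrete logarithm to base \<open>g\<close>, read modulo 3. The choice is harmless
  because two exponents of the same element agree modulo 3; the value 0 at zero lets sums run over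
  the whole field.\<close>

definition \<chi> :: "'a \<Rightarrow> complex" where
  "\<chi> x = (if x = \<zero> then 0 else \<omega> ^ (SOME i :: nat. g [^] i = x))"

lemma chi_zero [simp]: "\<chi> \<zero> = 0" by (simp add: \<chi>_def)

lemma chi_gen_power: "\<chi> (g [^] (i :: nat)) = \<omega> ^ i"
proof -
  have "g [^] (SOME j :: nat. g [^] j = g [^] i) = g [^] i" by (rule someI) auto
  hence "(SOME j :: nat. g [^] j = g [^] i) mod 3 = i mod 3" by (rule gen_power_eqD)
  hence "\<omega> ^ (SOME j :: nat. g [^] j = g [^] i) = \<omega> ^ i" by (simp only: omega_power_eq_iff)
  thus ?thesis by (simp add: \<chi>_def)
qed

lemma chi_one [simp]: "\<chi> \<one> = 1"
  using chi_gen_power[of 0] by simp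

lemma chi_mult:
  assumes "x \<in> carrier R" "y \<in> carrier R"
  shows "\<chi> (x \<otimes> y) = \<chi> x * \<chi> y"
proof (cases "x = \<zero> \<or> y = \<zero>")
  case True
  thus ?thesis using assms by auto
next
  case False
  then obtain i j :: nat where "x = g [^] i" "y = g [^] j"
    using assms nonzero_obtain_power by metis
  thus ?thesis using gen(1) by (simp add: nat_pow_mult chi_gen_power power_add)
qed

lemma chi_square:
  assumes "x \<in> carrier R"
  shows "(\<chi> x)\<^sup>2 = cnj (\<chi> x)"
proof (cases "x = \<zero>")
  case False
  then obtain i :: nat where "x = g [^] i" using assms nonzero_obtain_power by metis
  thus ?thesis by (simp add: chi_gen_power cnj_omega_power del: complex_cnj_power)
qed simp

lemma chi_mult_cnj:
  assumes "x \<in> carrier R" "x \<noteq> \<zero>"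
  shows "\<chi> x * cnj (\<chi> x) = 1"
proof -
  obtain i :: nat where "x = g [^] i" using assms nonzero_obtain_power by metis
  thus ?thesis by (simp add: chi_gen_power omega_norm flip: power_mult_distrib)
qed

lemma chi_eq_one_iff:
  assumes "x \<in> carrier R"
  shows "\<chi> x = 1 \<longleftrightarrow> x \<in> power_residues 3 R"
proof
  assume chi: "\<chi> x = 1"
  hence "x \<noteq> \<zero>" by auto
  then obtain i :: nat where i: "x = g [^] i" using assms nonzero_obtain_power by metis
  hence "3 dvd i" using chi by (simp add: chi_gen_power omega_power_eq_1_iff)
  then obtain k where "i = k * 3" by (metis dvdE mult.commute)
  hence "x = (g [^] k) [^] (3 :: nat)" using i gen(1) by (simp add: nat_pow_pow)
  thus "x \<in> power_residues 3 R" unfolding power_residues_def by force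
next
  assume "x \<in> power_residues 3 R"
  then obtain y where y: "y \<in> carrier R" "y \<noteq> \<zero>" "x = y [^] (3 :: nat)"
    unfolding power_residues_def by blast
  then obtain k :: nat where "y = g [^] k" using nonzero_obtain_power by metis
  hence "x = g [^] (k * 3)" using y(3) gen(1) by (simp add: nat_pow_pow)
  thus "\<chi> x = 1" by (simp add: chi_gen_power omega_power_eq_1_iff del: power_mult)
qed

text \<open>Minus one is its own cube, hence a cubic residue.\<close>

lemma chi_minus:
  assumes "x \<in> carrier R"
  shows "\<chi> (\<ominus> x) = \<chi> x"
proof -
  have "(\<ominus> \<one>) [^] (3 :: nat) = \<ominus> \<one>" by (simp add: numeral_3_eq_3 l_minus r_minus)
  moreover have "\<ominus> \<one> \<noteq> \<zero>" by (metis minus_minus minus_zero one_closed one_not_zero)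
  ultimately have "\<ominus> \<one> \<in> power_residues 3 R" unfolding power_residues_def by force
  hence "\<chi> (\<ominus> \<one>) = 1" by (simp add: chi_eq_one_iff)
  moreover have "\<ominus> x = \<ominus> \<one> \<otimes> x" using assms by (simp add: l_minus)
  ultimately show ?thesis using assms by (simp add: chi_mult del: l_minus)
qed

lemma minus_minus_cancel:
  assumes "a \<in> carrier R" "x \<in> carrier R"
  shows "a \<ominus> (a \<ominus> x) = x"
proof -
  have "a \<ominus> (a \<ominus> x) = a \<oplus> (\<ominus> a \<oplus> x)" using assms by (simp add: minus_eq minus_add)
  thus ?thesis using assms by (simp only: r_neg2)
qed

lemma minus_minus_minus:
  assumes "x \<in> carrier R" "y \<in> carrier R" "z \<in> carrier R"
  shows "z \<ominus> x \<ominus> (y \<ominus> x) = z \<ominus> y"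
proof -
  have "\<ominus> x \<oplus> (\<ominus> y \<oplus> x) = \<ominus> y"
    using assms by (metis a_comm r_neg1 a_inv_closed)
  thus ?thesis using assms by (simp add: minus_eq minus_add a_assoc)
qed

lemma mult_minus_one:
  assumes "a \<in> carrier R" "x \<in> carrier R"
  shows "a \<ominus> a \<otimes> x = a \<otimes> (\<one> \<ominus> x)"
  using assms by (simp add: minus_eq r_distr r_minus)

lemma sum_reflect:
  fixes f :: "'a \<Rightarrow> complex"
  assumes "a \<in> carrier R"
  shows "(\<Sum>x\<in>carrier R. f (a \<ominus> x)) = (\<Sum>x\<in>carrier R. f x)"
  by (rule sum.reindex_bij_witness[of _ "\<lambda>x. a \<ominus> x" "\<lambda>x. a \<ominus> x"])
     (use assms in \<open>simp_all add: minus_minus_cancel\<close>)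

lemma sum_translate:
  fixes f :: "'a \<Rightarrow> complex"
  assumes "a \<in> carrier R"
  shows "(\<Sum>x\<in>carrier R. f (x \<ominus> a)) = (\<Sum>x\<in>carrier R. f x)"
  by (rule sum.reindex_bij_witness[of _ "\<lambda>x. x \<oplus> a" "\<lambda>x. x \<ominus> a"])
     (use assms in \<open>simp_all add: minus_eq a_assoc r_neg l_neg\<close>)

lemma sum_dilate:
  fixes f :: "'a \<Rightarrow> complex"
  assumes "a \<in> carrier R" "a \<noteq> \<zero>"
  shows "(\<Sum>x\<in>carrier R. f (a \<otimes> x)) = (\<Sum>x\<in>carrier R. f x)"
proof -
  have inv: "inv a \<in> carrier R" "a \<otimes> inv a = \<one>" "inv a \<otimes> a = \<one>"
    using assms field_Units by auto
  show ?thesis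
    by (rule sum.reindex_bij_witness[of _ "\<lambda>x. inv a \<otimes> x" "\<lambda>x. a \<otimes> x"])
       (use assms inv in \<open>simp_all add: m_assoc [symmetric]\<close>)
qed

lemma sum_chi: "(\<Sum>x\<in>carrier R. \<chi> x) = 0"
proof -
  have g: "g \<noteq> \<zero>" using gen_power(2)[of 1] gen(1) by simp
  have "(\<Sum>x\<in>carrier R. \<chi> x) = (\<Sum>x\<in>carrier R. \<chi> (g \<otimes> x))"
    by (rule sum_dilate[OF gen(1) g, symmetric])
  also have "\<dots> = \<omega> * (\<Sum>x\<in>carrier R. \<chi> x)"
    using gen(1) chi_gen_power[of 1] by (simp add: chi_mult sum_distrib_left)
  finally have "(1 - \<omega>) * (\<Sum>x\<in>carrier R. \<chi> x) = 0" by (simp add: algebra_simps)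
  moreover have "\<omega> \<noteq> 1" using omega_power_eq_1_iff[of 1] by simp
  ultimately show ?thesis by simp
qed

lemma sum_chi': "(\<Sum>x\<in>carrier R. cnj (\<chi> x)) = 0"
proof -
  have "(\<Sum>x\<in>carrier R. cnj (\<chi> x)) = cnj (\<Sum>x\<in>carrier R. \<chi> x)" by simp
  thus ?thesis by (simp only: sum_chi complex_cnj_zero)
qed

section \<open>Convolution on the additive group and the convolutions of the character\<close>

definition conv :: "('a \<Rightarrow> complex) \<Rightarrow> ('a \<Rightarrow> complex) \<Rightarrow> 'a \<Rightarrow> complex" (infixl "\<star>" 70) where
  "(f \<star> h) z = (\<Sum>x\<in>carrier R. f x * h (z \<ominus> x))"

lemma conv_assoc:
  assumes "z \<in> carrier R"
  shows "((f \<star> h) \<star> k) z = (f \<star> (h \<star> k)) z"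
proof -
  have "((f \<star> h) \<star> k) z = (\<Sum>x\<in>carrier R. \<Sum>y\<in>carrier R. f x * (h (y \<ominus> x) * k (z \<ominus> y)))"
    unfolding conv_def sum_distrib_right mult.assoc by (rule sum.swap)
  also have "\<dots> = (\<Sum>x\<in>carrier R. f x * (\<Sum>y\<in>carrier R. h y * k (z \<ominus> x \<ominus> y)))"
  proof (intro sum.cong refl)
    fix x assume x: "x \<in> carrier R"
    have "(\<Sum>y\<in>carrier R. h y * k (z \<ominus> x \<ominus> y))
        = (\<Sum>y\<in>carrier R. h (y \<ominus> x) * k (z \<ominus> x \<ominus> (y \<ominus> x)))"
      by (rule sum_translate[OF x, symmetric])
    also have "\<dots> = (\<Sum>y\<in>carrier R. h (y \<ominus> x) * k (z \<ominus> y))"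
      using x assms by (intro sum.cong refl) (simp add: minus_minus_minus)
    finally show "(\<Sum>y\<in>carrier R. f x * (h (y \<ominus> x) * k (z \<ominus> y)))
        = f x * (\<Sum>y\<in>carrier R. h y * k (z \<ominus> x \<ominus> y))"
      by (simp add: sum_distrib_left)
  qed
  also have "\<dots> = (f \<star> (h \<star> k)) z" by (simp add: conv_def)
  finally show ?thesis .
qed

definition jacobi :: complex where
  "jacobi = (\<Sum>x\<in>carrier R. \<chi> x * \<chi> (\<one> \<ominus> x))"

abbreviation \<chi>' :: "'a \<Rightarrow> complex" where "\<chi>' x \<equiv> cnj (\<chi> x)"

text \<open>For nonzero \<open>z\<close> the substitution of \<open>z \<otimes> x\<close> for
  \<open>x\<close> pulls out the square of \<open>\<chi> z\<close>, which is its conjugate. At zero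
  the sum is that of the conjugate character, which vanishes.\<close>

lemma conv_chi_chi:
  assumes z: "z \<in> carrier R"
  shows "(\<chi> \<star> \<chi>) z = jacobi * \<chi>' z"
proof (cases "z = \<zero>")
  case True
  have "(\<chi> \<star> \<chi>) z = (\<Sum>x\<in>carrier R. \<chi>' x)"
    unfolding conv_def True
  proof (intro sum.cong refl)
    fix x assume x: "x \<in> carrier R"
    hence "\<zero> \<ominus> x = \<ominus> x" by (simp add: minus_eq)
    thus "\<chi> x * \<chi> (\<zero> \<ominus> x) = \<chi>' x"
      using chi_square[OF x] x by (simp add: chi_minus power2_eq_square)
  qed
  also have "\<dots> = 0" by (rule sum_chi')
  finally show ?thesis by (simp only: True chi_zero complex_cnj_zero mult_zero_right)
next
  case False
  have "(\<chi> \<star> \<chi>) z = (\<Sum>x\<in>carrier R. \<chi> (z \<otimes> x) * \<chi> (z \<ominus> z \<otimes> x))"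
    unfolding conv_def by (rule sum_dilate[OF z False, symmetric])
  also have "\<dots> = (\<Sum>x\<in>carrier R. \<chi>' z * (\<chi> x * \<chi> (\<one> \<ominus> x)))"
    using z by (intro sum.cong refl)
      (simp add: mult_minus_one chi_mult power2_eq_square flip: chi_square)
  finally show ?thesis by (simp add: jacobi_def flip: sum_distrib_left)
qed

lemma conv_chi'_chi': "z \<in> carrier R \<Longrightarrow> (\<chi>' \<star> \<chi>') z = cnj jacobi * \<chi> z"
  using arg_cong[OF conv_chi_chi, of z cnj] by (simp add: conv_def)

text \<open>Dilation makes the convolution constant away from zero. The constant follows from the
  value \<open>q - 1\<close> at zero and the total, which is a product of two vanishing character
  sums.\<close>

lemma conv_chi_chi':
  assumes z: "z \<in> carrier R"
  shows "(\<chi> \<star> \<chi>') z = (if z = \<zero> then of_nat (card (carrier R)) else 0) - 1"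
proof -
  let ?q = "of_nat (card (carrier R)) :: complex"
  have zero: "(\<chi> \<star> \<chi>') \<zero> = ?q - 1"
  proof -
    have "(\<chi> \<star> \<chi>') \<zero> = (\<Sum>x\<in>carrier R. if x = \<zero> then 0 else 1)"
      unfolding conv_def
    proof (intro sum.cong refl)
      fix x assume x: "x \<in> carrier R"
      hence "\<zero> \<ominus> x = \<ominus> x" by (simp add: minus_eq)
      thus "\<chi> x * \<chi>' (\<zero> \<ominus> x) = (if x = \<zero> then 0 else 1)"
        using x by (simp add: chi_minus chi_mult_cnj)
    qed
    also have "\<dots> = ?q - 1"
      using finite_carrier card_carrier by (simp add: sum.If_cases Int_absorb1 card_Diff_singleton
        flip: Diff_eq)
    finally show ?thesis .
  qed
  have const: "(\<chi> \<star> \<chi>') z = (\<chi> \<star> \<chi>') \<one>" if z: "z \<in> carrier R" "z \<noteq> \<zero>" for z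
  proof -
    have "(\<chi> \<star> \<chi>') z = (\<Sum>x\<in>carrier R. \<chi> (z \<otimes> x) * \<chi>' (z \<ominus> z \<otimes> x))"
      unfolding conv_def by (rule sum_dilate[OF z, symmetric])
    also have "\<dots> = (\<Sum>x\<in>carrier R. (\<chi> z * \<chi>' z) * (\<chi> x * \<chi>' (\<one> \<ominus> x)))"
      using z by (intro sum.cong refl) (simp add: mult_minus_one chi_mult)
    finally show ?thesis using z by (simp add: chi_mult_cnj conv_def)
  qed
  have "(\<Sum>z\<in>carrier R. (\<chi> \<star> \<chi>') z) = (\<Sum>x\<in>carrier R. \<chi> x * (\<Sum>z\<in>carrier R. \<chi>' (z \<ominus> x)))"
    unfolding conv_def sum_distrib_left by (rule sum.swap)
  also have "\<dots> = (\<Sum>x\<in>carrier R. \<chi> x * cnj (\<Sum>z\<in>carrier R. \<chi> z))"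
  proof (intro sum.cong refl)
    fix x assume "x \<in> carrier R"
    thus "\<chi> x * (\<Sum>z\<in>carrier R. \<chi>' (z \<ominus> x)) = \<chi> x * cnj (\<Sum>z\<in>carrier R. \<chi> z)"
      using sum_translate[of x "\<lambda>z. \<chi>' z"] by simp
  qed
  also have "\<dots> = 0" by (simp only: sum_chi) simp
  finally have "0 = (\<Sum>z\<in>carrier R. (\<chi> \<star> \<chi>') z)" ..
  also have "\<dots> = (\<chi> \<star> \<chi>') \<zero> + (\<Sum>z\<in>carrier R - {\<zero>}. (\<chi> \<star> \<chi>') z)"
    using finite_carrier by (subst sum.remove[of _ \<zero>]) auto
  also have "(\<Sum>z\<in>carrier R - {\<zero>}. (\<chi> \<star> \<chi>') z) = (\<Sum>z\<in>carrier R - {\<zero>}. (\<chi> \<star> \<chi>') \<one>)"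
    by (intro sum.cong refl const) auto
  also have "\<dots> = (?q - 1) * (\<chi> \<star> \<chi>') \<one>"
    using card_carrier finite_carrier by (simp add: card_Diff_singleton)
  finally have "(?q - 1) + (?q - 1) * (\<chi> \<star> \<chi>') \<one> = 0" unfolding zero ..
  hence "(?q - 1) * ((\<chi> \<star> \<chi>') \<one> + 1) = 0" by (simp only: distrib_left mult_1_right add.commute)
  hence "(\<chi> \<star> \<chi>') \<one> = - 1" using n_pos card_carrier by (simp add: eq_neg_iff_add_eq_0)
  thus ?thesis using zero const[OF z] by auto
qed

text \<open>The triple convolution of \<chi>, \<chi> and its conjugate is evaluated at one with both
  bracketings: one gives the squared modulus, the other \<open>q * \<chi> \<one>\<close>.\<close>

lemma jacobi_norm: "jacobi * cnj jacobi = of_nat (card (carrier R))"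
proof -
  let ?q = "of_nat (card (carrier R)) :: complex"
  have "jacobi * cnj jacobi = jacobi * (\<chi>' \<star> \<chi>') \<one>" by (simp add: conv_chi'_chi')
  also have "\<dots> = ((\<chi> \<star> \<chi>) \<star> \<chi>') \<one>"
    unfolding conv_def[of "\<chi> \<star> \<chi>"] conv_def[of \<chi>'] sum_distrib_left
    by (intro sum.cong refl) (simp add: conv_chi_chi mult.assoc)
  also have "\<dots> = (\<chi> \<star> (\<chi> \<star> \<chi>')) \<one>" by (rule conv_assoc) simp
  also have "\<dots> = (\<Sum>x\<in>carrier R. \<chi> x * (if x = \<one> then ?q else 0) - \<chi> x)"
    unfolding conv_def[of \<chi> "\<chi> \<star> \<chi>'"]
    by (intro sum.cong refl) (auto simp: conv_chi_chi' algebra_simps)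
  also have "\<dots> = ?q"
    using finite_carrier by (simp add: sum_subtractf sum_chi if_distrib[of "\<lambda>a. _ * a"] sum.delta cong: if_cong)
  finally show ?thesis .
qed

section \<open>The spectra of the graph and of its complement\<close>

text \<open>A circulant over the additive group of the field, which need not be cyclic; convolution
  turns into the matrix product.\<close>

definition circulant :: "'a list \<Rightarrow> ('a \<Rightarrow> complex) \<Rightarrow> complex mat" where
  "circulant vs f = mat (length vs) (length vs) (\<lambda>(i, j). f (vs ! j \<ominus> vs ! i))"

lemma circulant_carrier: "circulant vs f \<in> carrier_mat (length vs) (length vs)"
  by (simp add: circulant_def)

lemma circulant_mult:
  assumes vs: "distinct vs" "set vs = carrier R"
  shows "circulant vs f * circulant vs h = circulant vs (f \<star> h)"
proof (rule eq_matI)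
  fix i j assume "i < dim_row (circulant vs (f \<star> h))" "j < dim_col (circulant vs (f \<star> h))"
  hence ij: "i < length vs" "j < length vs" by (simp_all add: circulant_def)
  hence el: "vs ! i \<in> carrier R" "vs ! j \<in> carrier R" using vs(2) nth_mem by blast+
  have "(circulant vs f * circulant vs h) $$ (i, j)
      = (\<Sum>k<length vs. f (vs ! k \<ominus> vs ! i) * h (vs ! j \<ominus> vs ! k))"
    using ij by (simp add: circulant_def scalar_prod_def lessThan_atLeast0)
  also have "\<dots> = (\<Sum>x\<in>carrier R. f (x \<ominus> vs ! i) * h (vs ! j \<ominus> x))"
    by (rule sum.reindex_bij_betw[OF bij_betw_nth]) (use vs in auto)
  also have "\<dots> = (\<Sum>x\<in>carrier R. f (x \<ominus> vs ! i) * h (vs ! j \<ominus> vs ! i \<ominus> (x \<ominus> vs ! i)))"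
    using el by (intro sum.cong refl) (simp add: minus_minus_minus)
  also have "\<dots> = (f \<star> h) (vs ! j \<ominus> vs ! i)"
    unfolding conv_def by (rule sum_translate[OF el(1)])
  finally show "(circulant vs f * circulant vs h) $$ (i, j) = circulant vs (f \<star> h) $$ (i, j)"
    using ij by (simp add: circulant_def)
qed (simp_all add: circulant_def)

abbreviation q :: complex where "q \<equiv> of_nat (card (carrier R))"

lemma q_nonzero: "q \<noteq> 0" "q - 1 = 3 * of_nat n"
proof -
  show "q \<noteq> 0" by (simp add: card_carrier del: of_nat_Suc)
  show "q - 1 = 3 * of_nat n" by (simp add: card_carrier)
qed

definition \<delta> :: "'a \<Rightarrow> complex" where "\<delta> z = (if z = \<zero> then 1 else 0)"

text \<open>For a cube root \<open>\<gamma>\<close> of \<open>q\<close> times the Jacobi sum, convolution with \<open>\<chi>\<close> acts as \<open>\<gamma>\<close> on the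
  idempotent below; \<open>\<gamma>\<close> plays the role of a cubic Gauss sum, without any additive character.\<close>

definition proj :: "complex \<Rightarrow> 'a \<Rightarrow> complex" where
  "proj \<gamma> z = (\<delta> z - 1 / q + (cnj \<gamma> * \<chi> z + \<gamma> * \<chi>' z) / q) / 3"

lemma cube_root_norm:
  assumes "\<gamma> ^ 3 = q * jacobi"
  shows "\<gamma> * cnj \<gamma> = q"
proof -
  let ?Q = "real (card (carrier R))"
  have "(jacobi * cnj jacobi) = of_real ((cmod jacobi)\<^sup>2)"
    by (simp only: complex_norm_square)
  hence J: "(cmod jacobi)\<^sup>2 = ?Q"
    unfolding jacobi_norm by (metis of_real_eq_iff of_real_of_nat_eq)
  have "((cmod \<gamma>)\<^sup>2) ^ 3 = (cmod (\<gamma> ^ 3))\<^sup>2"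
    by (simp add: norm_power mult.commute flip: power_mult)
  also have "\<dots> = ?Q\<^sup>2 * (cmod jacobi)\<^sup>2"
    unfolding assms by (simp add: norm_mult power_mult_distrib)
  also have "\<dots> = ?Q ^ 3" unfolding J by (simp add: power2_eq_square power3_eq_cube)
  finally have "(cmod \<gamma>)\<^sup>2 = ?Q" by (rule power_eq_imp_eq_base) auto
  moreover have "\<gamma> * cnj \<gamma> = of_real ((cmod \<gamma>)\<^sup>2)" by (simp only: complex_norm_square)
  ultimately show ?thesis by simp
qed

text \<open>For the cubic Gauss sum in the role of \<gamma> this is the classical factorization of
  its square; here it follows from the defining cube and the modulus alone.\<close>

lemma cube_root_jacobi:
  assumes "\<gamma> ^ 3 = q * jacobi"
  shows "cnj \<gamma> * jacobi = \<gamma>\<^sup>2"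
proof -
  have "q * (cnj \<gamma> * jacobi) = cnj \<gamma> * \<gamma> ^ 3" by (simp add: assms mult_ac)
  also have "\<dots> = q * \<gamma>\<^sup>2"
    unfolding cube_root_norm[OF assms, symmetric] by (simp add: power2_eq_square power3_eq_cube mult_ac)
  finally show ?thesis using q_nonzero(1) by simp
qed

lemma sum_delta: "(\<Sum>x\<in>carrier R. \<delta> x * f x) = f \<zero>"
  using finite_carrier by (simp add: \<delta>_def if_distrib[of "\<lambda>a. a * _"] sum.delta cong: if_cong)

lemma conv_delta_left: "z \<in> carrier R \<Longrightarrow> (\<delta> \<star> f) z = f z"
  by (simp add: conv_def sum_delta minus_eq)

lemma conv_delta_right:
  assumes "z \<in> carrier R"
  shows "(f \<star> \<delta>) z = f z"
proof -
  have "(f \<star> \<delta>) z = (\<Sum>x\<in>carrier R. \<delta> (z \<ominus> x) * f (z \<ominus> (z \<ominus> x)))"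
    unfolding conv_def using assms by (intro sum.cong refl) (simp add: minus_minus_cancel mult.commute)
  also have "\<dots> = (\<Sum>x\<in>carrier R. \<delta> x * f (z \<ominus> x))"
    by (rule sum_reflect[OF assms])
  also have "\<dots> = f z" using assms by (simp add: sum_delta minus_eq)
  finally show ?thesis .
qed

lemma conv_chi_proj:
  assumes \<gamma>: "\<gamma> ^ 3 = q * jacobi" and z: "z \<in> carrier R"
  shows "(\<chi> \<star> proj \<gamma>) z = \<gamma> * proj \<gamma> z"
proof -
  have "(\<chi> \<star> proj \<gamma>) z = ((\<chi> \<star> \<delta>) z - (\<Sum>x\<in>carrier R. \<chi> x) / q
      + (cnj \<gamma> * (\<chi> \<star> \<chi>) z + \<gamma> * (\<chi> \<star> \<chi>') z) / q) / 3"
    unfolding conv_def proj_def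
    by (simp add: algebra_simps add_divide_distrib diff_divide_distrib sum.distrib sum_subtractf
        sum_distrib_left sum_divide_distrib)
  also have "\<dots> = (\<chi> z + (\<gamma>\<^sup>2 * \<chi>' z + \<gamma> * (q * \<delta> z - 1)) / q) / 3"
    using z by (simp add: conv_delta_right sum_chi conv_chi_chi conv_chi_chi' \<delta>_def
        flip: cube_root_jacobi[OF \<gamma>])
  \<comment> \<open>The factor \<open>\<gamma> * cnj \<gamma> / q\<close>, equal to 1, is inserted
    so that \<gamma> can be taken out of every term.\<close>
  also have "\<dots> = (\<gamma> * cnj \<gamma> * \<chi> z / q + (\<gamma>\<^sup>2 * \<chi>' z + \<gamma> * (q * \<delta> z - 1)) / q) / 3"
    unfolding cube_root_norm[OF \<gamma>] using q_nonzero(1) by simp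
  also have "\<dots> = \<gamma> * proj \<gamma> z"
    unfolding proj_def using q_nonzero(1) by (simp add: field_simps power2_eq_square)
  finally show ?thesis .
qed

lemma proj_real: "cnj (proj \<gamma> z) = proj \<gamma> z"
  by (simp add: proj_def \<delta>_def add.commute)

lemma conv_chi'_proj:
  assumes \<gamma>: "\<gamma> ^ 3 = q * jacobi" and z: "z \<in> carrier R"
  shows "(\<chi>' \<star> proj \<gamma>) z = cnj \<gamma> * proj \<gamma> z"
  using arg_cong[OF conv_chi_proj[OF assms], of cnj] by (simp add: conv_def proj_real)

lemma sum_proj: "(\<Sum>z\<in>carrier R. proj \<gamma> z) = 0"
proof -
  have "(\<Sum>z\<in>carrier R. \<delta> z) = 1" using sum_delta[of "\<lambda>_. 1"] by simp
  thus ?thesis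
    using q_nonzero(1) by (simp add: proj_def sum.distrib sum_subtractf sum_chi sum_chi'
        flip: sum_distrib_left sum_divide_distrib)
qed

definition lin_fun :: "complex \<Rightarrow> complex \<Rightarrow> complex \<Rightarrow> 'a \<Rightarrow> complex" where
  "lin_fun a b c z = a + b * \<delta> z + c * (\<chi> z + \<chi>' z)"

lemma conv_lin_fun:
  assumes "z \<in> carrier R"
  shows "(lin_fun a b c \<star> f) z
    = a * (\<Sum>x\<in>carrier R. f x) + b * f z + c * ((\<chi> \<star> f) z + (\<chi>' \<star> f) z)"
proof -
  have "(lin_fun a b c \<star> f) z = a * (\<Sum>x\<in>carrier R. f (z \<ominus> x)) + b * (\<delta> \<star> f) z
      + c * ((\<chi> \<star> f) z + (\<chi>' \<star> f) z)"
    unfolding conv_def lin_fun_def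
    by (simp add: algebra_simps sum.distrib sum_distrib_left)
  thus ?thesis using assms by (simp add: conv_delta_left sum_reflect)
qed

text \<open>The three cube roots give three idempotents, completed by the constant function
  \<open>1 / q\<close>. In the sum of all four the character terms cancel by
  \<open>omega_sum\<close>, and each of the three has trace \<open>(q - 1) / 3\<close>.\<close>

lemma spectrum_circulant_lin_fun:
  assumes vs: "distinct vs" "set vs = carrier R" and \<gamma>: "\<gamma> ^ 3 = q * jacobi"
  shows "proots (char_poly (circulant vs (lin_fun a b c)))
    = {#a * q + b#} + (\<Sum>k<3. replicate_mset n (b + c * of_real (2 * Re (\<gamma> * \<omega> ^ k))))"
proof -
  let ?\<gamma> = "\<lambda>k. \<gamma> * \<omega> ^ k"
  have len: "length vs = card (carrier R)" using vs distinct_card by metis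
  have \<gamma>k: "(?\<gamma> k) ^ 3 = q * jacobi" for k
    using \<gamma> by (simp add: power_mult_distrib omega_power_cube)
  \<comment> \<open>Index 3 carries the constant function, whose eigenvalue is the valency when the
    circulant is an adjacency matrix.\<close>
  define f where "f k = (if k < 3 then proj (?\<gamma> k) else (\<lambda>_. 1 / q))" for k :: nat
  define r where "r k = (if k < 3 then b + c * of_real (2 * Re (?\<gamma> k)) else a * q + b)" for k :: nat
  define m where "m k = (if k < 3 then n else 1)" for k :: nat
  have conv: "(lin_fun a b c \<star> f k) z = r k * f k z" if z: "z \<in> carrier R" for k z
  proof (cases "k < 3")
    case True
    have fk: "f k = proj (?\<gamma> k)" using True by (simp add: f_def)
    have "(lin_fun a b c \<star> f k) z = b * proj (?\<gamma> k) z
        + c * (?\<gamma> k * proj (?\<gamma> k) z + cnj (?\<gamma> k) * proj (?\<gamma> k) z)"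
      unfolding fk conv_lin_fun[OF z] sum_proj conv_chi_proj[OF \<gamma>k z] conv_chi'_proj[OF \<gamma>k z] by simp
    also have "\<dots> = (b + c * (?\<gamma> k + cnj (?\<gamma> k))) * proj (?\<gamma> k) z" by (simp add: algebra_simps)
    finally show ?thesis using True unfolding complex_add_cnj by (simp add: f_def r_def)
  next
    case False
    have "(\<chi> \<star> f k) z = 0" "(\<chi>' \<star> f k) z = 0"
      using False sum_chi sum_chi'
      by (simp_all add: conv_def f_def flip: sum_divide_distrib)
    thus ?thesis using False z q_nonzero(1) by (simp add: conv_lin_fun f_def r_def field_simps)
  qed
  have "proots (char_poly (circulant vs (lin_fun a b c))) = (\<Sum>k\<in>{..<4}. replicate_mset (m k) (r k))"
  proof (rule proots_char_poly_resolution_of_identity[where E = "\<lambda>k. circulant vs (f k)"])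
    show "circulant vs (lin_fun a b c) * circulant vs (f k) = r k \<cdot>\<^sub>m circulant vs (f k)" for k
      unfolding circulant_mult[OF vs]
    proof (rule eq_matI)
      fix i j assume "i < dim_row (r k \<cdot>\<^sub>m circulant vs (f k))" "j < dim_col (r k \<cdot>\<^sub>m circulant vs (f k))"
      hence ij: "i < length vs" "j < length vs" by (simp_all add: circulant_def)
      hence "vs ! j \<ominus> vs ! i \<in> carrier R" using vs(2) nth_mem by blast
      thus "circulant vs (lin_fun a b c \<star> f k) $$ (i, j) = (r k \<cdot>\<^sub>m circulant vs (f k)) $$ (i, j)"
        using ij by (simp add: circulant_def conv)
    qed (simp_all add: circulant_def)
    show "(\<Sum>k<4. circulant vs (f k) $$ (i, j)) = (if i = j then 1 else 0)"
      if ij: "i < length vs" "j < length vs" for i j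
    proof -
      let ?z = "vs ! j \<ominus> vs ! i"
      have el: "vs ! i \<in> carrier R" "vs ! j \<in> carrier R" using ij vs(2) nth_mem by blast+
      have "(\<Sum>k<4. f k ?z) = \<delta> ?z + (cnj (\<gamma> * (1 + \<omega> + \<omega>\<^sup>2)) * \<chi> ?z + \<gamma> * (1 + \<omega> + \<omega>\<^sup>2) * \<chi>' ?z) / q / 3"
        using q_nonzero(1) by (simp add: f_def proj_def eval_nat_numeral field_simps)
      also have "\<dots> = \<delta> ?z" by (simp only: omega_sum) simp
      also have "\<dots> = (if i = j then 1 else 0)"
        using el ij vs(1) by (simp add: \<delta>_def nth_eq_iff_index_eq)
      finally show ?thesis using ij by (simp add: circulant_def)
    qed
    show "(\<Sum>i<length vs. circulant vs (f k) $$ (i, i)) = of_nat (m k)" for k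
    proof -
      have "vs ! i \<ominus> vs ! i = \<zero>" if "i < length vs" for i
        using that vs(2) nth_mem by (metis minus_eq r_neg)
      hence "(\<Sum>i<length vs. circulant vs (f k) $$ (i, i)) = q * f k \<zero>"
        by (simp add: circulant_def len)
      also have "\<dots> = of_nat (m k)"
      proof (cases "k < 3")
        case True
        have "q * f k \<zero> = (q - 1) / 3" using True q_nonzero(1) by (simp add: f_def proj_def \<delta>_def field_simps)
        thus ?thesis using True q_nonzero(2) by (simp add: m_def)
      qed (use q_nonzero(1) in \<open>simp add: f_def m_def\<close>)
      finally show ?thesis .
    qed
  qed (auto simp: circulant_carrier)
  also have "\<dots> = {#a * q + b#} + (\<Sum>k<3. replicate_mset n (b + c * of_real (2 * Re (?\<gamma> k))))"
    by (simp add: m_def r_def eval_nat_numeral)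
  finally show ?thesis .
qed

section \<open>The two adjacency matrices as circulants\<close>

lemma vertex_list:
  assumes "pverts G = carrier R"
  shows "distinct (vertex_list G)" "set (vertex_list G) = carrier R"
proof -
  obtain vs where "distinct vs \<and> set vs = pverts G"
    using finite_distinct_list[OF finite_carrier] assms by auto
  hence "distinct (vertex_list G) \<and> set (vertex_list G) = pverts G"
    unfolding vertex_list_def by (rule someI)
  thus "distinct (vertex_list G)" "set (vertex_list G) = carrier R" using assms by auto
qed

lemma adjacency_matrix_circulant:
  assumes "pverts G = carrier R"
    and "\<And>v w. v \<in> carrier R \<Longrightarrow> w \<in> carrier R \<Longrightarrow> f (w \<ominus> v) = (if (v, w) \<in> parcs G then 1 else 0)"
  shows "adjacency_matrix G = circulant (vertex_list G) f"
proof -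
  have "vertex_list G ! i \<in> carrier R" if "i < length (vertex_list G)" for i
    using that vertex_list(2)[OF assms(1)] nth_mem by blast
  thus ?thesis unfolding adjacency_matrix_def circulant_def Let_def
    by (intro eq_matI) (auto simp: assms(2))
qed

text \<open>Away from zero this is the sum over the three characters of order dividing 3, which
  detects cubes; the term \<open>\<delta> z\<close> corrects the value at zero.\<close>

lemma indicator_power_residues:
  assumes "z \<in> carrier R"
  shows "1 - \<delta> z + \<chi> z + \<chi>' z = (if z \<in> power_residues 3 R then 3 else 0)"
proof (cases "z = \<zero>")
  case True
  thus ?thesis using chi_eq_one_iff[OF assms] by (auto simp: \<delta>_def)
next
  case False
  have "\<chi> z ^ 3 = 1"
    using chi_mult_cnj[OF assms False] chi_square[OF assms] by (simp add: power3_eq_cube power2_eq_square mult.commute)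
  hence "(\<chi> z - 1) * (1 + \<chi> z + (\<chi> z)\<^sup>2) = 0" by (simp add: algebra_simps power2_eq_square power3_eq_cube)
  hence "\<chi> z = 1 \<or> 1 + \<chi> z + \<chi>' z = 0" using chi_square[OF assms] by simp
  thus ?thesis using False by (auto simp: \<delta>_def simp flip: chi_eq_one_iff[OF assms])
qed

lemma adjacency_gen_paley:
  "adjacency_matrix (gen_paley 3 R) = circulant (vertex_list (gen_paley 3 R)) (lin_fun (1 / 3) (- 1 / 3) (1 / 3))"
proof (rule adjacency_matrix_circulant)
  fix v w assume vw: "v \<in> carrier R" "w \<in> carrier R"
  hence z: "w \<ominus> v \<in> carrier R" by simp
  have "lin_fun (1 / 3) (- 1 / 3) (1 / 3) (w \<ominus> v) = (1 - \<delta> (w \<ominus> v) + \<chi> (w \<ominus> v) + \<chi>' (w \<ominus> v)) / 3"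
    by (simp add: lin_fun_def field_simps)
  also have "\<dots> = (if (v, w) \<in> parcs (gen_paley 3 R) then 1 else 0)"
    unfolding indicator_power_residues[OF z] using vw by (simp add: gen_paley_def)
  finally show "lin_fun (1 / 3) (- 1 / 3) (1 / 3) (w \<ominus> v) = (if (v, w) \<in> parcs (gen_paley 3 R) then 1 else 0)" .
qed (simp add: gen_paley_def)

lemma adjacency_complement_gen_paley:
  "adjacency_matrix (complement_graph (gen_paley 3 R))
    = circulant (vertex_list (complement_graph (gen_paley 3 R))) (lin_fun (2 / 3) (- 2 / 3) (- 1 / 3))"
proof (rule adjacency_matrix_circulant)
  fix v w assume vw: "v \<in> carrier R" "w \<in> carrier R"
  hence z: "w \<ominus> v \<in> carrier R" by simp
  have vv: "v \<ominus> v = \<zero>" using vw by (simp add: minus_eq r_neg)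
  have "lin_fun (2 / 3) (- 2 / 3) (- 1 / 3) (w \<ominus> v)
      = 1 - \<delta> (w \<ominus> v) - (1 - \<delta> (w \<ominus> v) + \<chi> (w \<ominus> v) + \<chi>' (w \<ominus> v)) / 3"
    by (simp add: lin_fun_def field_simps)
  also have "\<dots> = (if (v, w) \<in> parcs (complement_graph (gen_paley 3 R)) then 1 else 0)"
    unfolding indicator_power_residues[OF z]
    using vw chi_eq_one_iff[of \<zero>] by (auto simp: vv complement_graph_def gen_paley_def \<delta>_def)
  finally show "lin_fun (2 / 3) (- 2 / 3) (- 1 / 3) (w \<ominus> v)
    = (if (v, w) \<in> parcs (complement_graph (gen_paley 3 R)) then 1 else 0)" .
qed (simp add: gen_paley_def complement_graph_def)

text \<open>These are the reduced cubic Gaussian periods; the periods themselves are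
  \<open>(eig \<gamma> k - 1) / 3\<close>.\<close>

definition eig :: "complex \<Rightarrow> nat \<Rightarrow> real" where "eig \<gamma> k = 2 * Re (\<gamma> * \<omega> ^ k)"

lemma spectrum_gen_paley:
  assumes "\<gamma> ^ 3 = q * jacobi"
  shows "graph_spectrum (gen_paley 3 R)
    = {#of_nat n#} + (\<Sum>k<3. replicate_mset n (of_real ((eig \<gamma> k - 1) / 3)))"
proof -
  have e: "- 1 / 3 + 1 / 3 * of_real x = (of_real ((x - 1) / 3) :: complex)" for x
    by (simp add: complex_eq_iff field_simps)
  have "graph_spectrum (gen_paley 3 R) = {#1 / 3 * q + - 1 / 3#}
      + (\<Sum>k<3. replicate_mset n (- 1 / 3 + 1 / 3 * of_real (2 * Re (\<gamma> * \<omega> ^ k))))"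
    unfolding graph_spectrum_def adjacency_gen_paley
    by (intro spectrum_circulant_lin_fun vertex_list assms) (simp_all add: gen_paley_def)
  also have "1 / 3 * q + - 1 / 3 = of_nat n" using q_nonzero(2) by (simp add: field_simps)
  finally show ?thesis unfolding e eig_def [symmetric] .
qed

lemma spectrum_complement_gen_paley:
  assumes "\<gamma> ^ 3 = q * jacobi"
  shows "graph_spectrum (complement_graph (gen_paley 3 R))
    = {#of_nat (2 * n)#} + (\<Sum>k<3. replicate_mset n (of_real (- (eig \<gamma> k + 2) / 3)))"
proof -
  have e: "- 2 / 3 + - 1 / 3 * of_real x = (of_real (- (x + 2) / 3) :: complex)" for x
    by (simp add: complex_eq_iff field_simps)
  have "graph_spectrum (complement_graph (gen_paley 3 R)) = {#2 / 3 * q + - 2 / 3#}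
      + (\<Sum>k<3. replicate_mset n (- 2 / 3 + - 1 / 3 * of_real (2 * Re (\<gamma> * \<omega> ^ k))))"
    unfolding graph_spectrum_def adjacency_complement_gen_paley
    by (intro spectrum_circulant_lin_fun vertex_list assms) (simp_all add: gen_paley_def complement_graph_def)
  also have "2 / 3 * q + - 2 / 3 = of_nat (2 * n)" using q_nonzero(2) by (simp add: field_simps)
  finally show ?thesis unfolding e eig_def [symmetric] .
qed

end

text \<open>Once one root is at least 1 and two are at most \<open>- 2\<close>, both sums are linear
  in the roots and differ by \<open>(- 1 + 1 + 1) - (2 - 2 - 2) = 3\<close>. Weighted by
  \<open>n / 3\<close>, this offsets the gap between the valencies \<open>n\<close> and
  \<open>2 * n\<close>.\<close>

lemma cubic_sign_energy:
  fixes y :: "nat \<Rightarrow> real"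
  assumes Q1: "Q \<ge> 1" and c: "c \<ge> 6" and sum: "y 0 + y 1 + y 2 = 0"
    and root: "\<And>k. k < 3 \<Longrightarrow> y k ^ 3 = 3 * Q * y k + Q * c"
  shows "(\<Sum>k<3. \<bar>y k - 1\<bar>) = 3 + (\<Sum>k<3. \<bar>y k + 2\<bar>)"
proof -
  have Q: "Q > 0" using Q1 by simp
  have pos: "y k \<ge> 1 \<and> (y k)\<^sup>2 > 3 * Q" if "k < 3" "y k \<ge> 0" for k
  proof -
    have "y k * ((y k)\<^sup>2 - 3 * Q) = Q * c" using root[OF that(1)] by (simp add: algebra_simps power2_eq_square power3_eq_cube)
    also have "\<dots> > 0" using Q c by simp
    finally have *: "(y k)\<^sup>2 > 3 * Q" using that(2) by (simp add: zero_less_mult_iff)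
    hence "(y k)\<^sup>2 \<ge> 1\<^sup>2" using Q1 by simp
    hence "y k \<ge> 1" using that(2) power2_le_imp_le by blast
    with * show ?thesis by blast
  qed
  have neg: "y k \<le> - 2 \<and> (y k)\<^sup>2 \<le> 3 * Q" if "k < 3" "y k < 0" for k
  proof -
    have e: "- y k * (3 * Q - (y k)\<^sup>2) = Q * c" using root[OF that(1)] by (simp add: algebra_simps power2_eq_square power3_eq_cube)
    also have "\<dots> > 0" using Q c by simp
    finally have *: "(y k)\<^sup>2 < 3 * Q" using that(2) by (simp add: zero_less_mult_iff mult_less_0_iff)
    \<comment> \<open>The source of the constant 6: dropping the square leaves
      \<open>6 * Q \<le> - 3 * Q * y k\<close>.\<close>
    have "Q * 6 \<le> - y k * (3 * Q - (y k)\<^sup>2)" unfolding e using Q c by simp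
    also have "\<dots> \<le> - y k * (3 * Q)" using that(2) by (intro mult_left_mono) auto
    finally have "Q * 6 \<le> Q * (- y k * 3)" by (simp add: mult_ac)
    hence "6 \<le> - y k * 3" by (simp only: mult_le_cancel_left_pos[OF Q])
    with * show ?thesis by linarith
  qed
  \<comment> \<open>The third root would be negative with modulus at least \<open>y i\<close>, but
    squares of positive roots exceed \<open>3 * Q\<close> and those of negative roots do
    not.\<close>
  have two: False if "i < 3" "j < 3" "k < 3" "y i + y j + y k = 0" "y i \<ge> 0" "y j \<ge> 0" for i j k
  proof -
    have i: "y i \<ge> 1" "(y i)\<^sup>2 > 3 * Q" and j: "y j \<ge> 1" using pos that by auto
    have k: "y k = - (y i + y j)" using that(4) by simp
    have "(y k)\<^sup>2 \<le> 3 * Q" using neg[OF that(3)] k i j by simp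
    moreover have "(y i)\<^sup>2 \<le> (y k)\<^sup>2" 
    proof -
      have "(y i)\<^sup>2 \<le> (y i + y j)\<^sup>2" using i j by (intro power_mono) auto
      thus ?thesis unfolding k power2_minus .
    qed
    ultimately show False using i by simp
  qed
  have exp: "(\<Sum>k<3. f k) = f 0 + f 1 + f 2" for f :: "nat \<Rightarrow> real" by (simp add: eval_nat_numeral)
  have d: "y k \<ge> 1 \<or> y k \<le> - 2" if "k < 3" for k
    using pos[OF that] neg[OF that] by (cases "y k \<ge> 0") auto
  have "\<not> (y 0 \<ge> 0 \<and> y 1 \<ge> 0)" using two[of 0 1 2] sum by auto
  moreover have "\<not> (y 0 \<ge> 0 \<and> y 2 \<ge> 0)" using two[of 0 2 1] sum by auto
  moreover have "\<not> (y 1 \<ge> 0 \<and> y 2 \<ge> 0)" using two[of 1 2 0] sum by auto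
  moreover have "y 0 \<ge> 1 \<or> y 0 \<le> - 2" "y 1 \<ge> 1 \<or> y 1 \<le> - 2" "y 2 \<ge> 1 \<or> y 2 \<le> - 2"
    using d[of 0] d[of 1] d[of 2] by auto
  ultimately consider "y 0 \<ge> 1" "y 1 \<le> - 2" "y 2 \<le> - 2" | "y 0 \<le> - 2" "y 1 \<ge> 1" "y 2 \<le> - 2"
    | "y 0 \<le> - 2" "y 1 \<le> - 2" "y 2 \<ge> 1"
    using sum by linarith
  thus ?thesis unfolding exp using sum by cases linarith+
qed

context cubic_field
begin

lemma eig_cubic:
  assumes \<gamma>: "\<gamma> ^ 3 = q * jacobi"
  shows "eig \<gamma> k ^ 3 = 3 * real (card (carrier R)) * eig \<gamma> k + real (card (carrier R)) * (2 * Re jacobi)"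
    and "(eig \<gamma> k)\<^sup>2 \<le> 4 * real (card (carrier R))"
    and "eig \<gamma> 0 + eig \<gamma> 1 + eig \<gamma> 2 = 0"
proof -
  let ?\<gamma> = "\<gamma> * \<omega> ^ k" and ?Q = "real (card (carrier R))"
  have \<gamma>k: "?\<gamma> ^ 3 = q * jacobi"
    using \<gamma> by (simp add: power_mult_distrib omega_power_cube)
  have y: "of_real (eig \<gamma> k) = ?\<gamma> + cnj ?\<gamma>" by (simp only: eig_def complex_add_cnj)
  have "complex_of_real (eig \<gamma> k ^ 3) = (?\<gamma> + cnj ?\<gamma>) ^ 3" by (simp only: of_real_power y)
  also have "\<dots> = ?\<gamma> ^ 3 + cnj (?\<gamma> ^ 3) + 3 * (?\<gamma> * cnj ?\<gamma>) * (?\<gamma> + cnj ?\<gamma>)"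
    by (simp add: power3_eq_cube algebra_simps)
  also have "\<dots> = q * (jacobi + cnj jacobi) + 3 * q * of_real (eig \<gamma> k)"
    unfolding \<gamma>k cube_root_norm[OF \<gamma>k] y by (simp add: algebra_simps)
  also have "\<dots> = of_real (3 * ?Q * eig \<gamma> k + ?Q * (2 * Re jacobi))"
    unfolding complex_add_cnj by simp
  finally show "eig \<gamma> k ^ 3 = 3 * ?Q * eig \<gamma> k + ?Q * (2 * Re jacobi)"
    by (simp only: of_real_eq_iff)
  have "of_real ((cmod ?\<gamma>)\<^sup>2) = q" using cube_root_norm[OF \<gamma>k] by (simp only: complex_norm_square)
  hence "(cmod ?\<gamma>)\<^sup>2 = ?Q" by (metis of_real_eq_iff of_real_of_nat_eq)
  moreover have "(Re ?\<gamma>)\<^sup>2 \<le> (cmod ?\<gamma>)\<^sup>2" unfolding cmod_power2 by simp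
  ultimately show "(eig \<gamma> k)\<^sup>2 \<le> 4 * ?Q" unfolding eig_def power_mult_distrib by simp
  have "eig \<gamma> 0 + eig \<gamma> 1 + eig \<gamma> 2 = 2 * Re (\<gamma> * (1 + \<omega> + \<omega>\<^sup>2))"
    by (simp add: eig_def algebra_simps)
  also have "\<dots> = 0" by (simp only: omega_sum) simp
  finally show "eig \<gamma> 0 + eig \<gamma> 1 + eig \<gamma> 2 = 0" .
qed

lemma cube_root_exists: "\<exists>\<gamma>. \<gamma> ^ 3 = q * jacobi"
proof -
  let ?w = "q * jacobi"
  have "(rcis (root 3 (cmod ?w)) (Arg ?w / 3)) ^ 3 = ?w"
    unfolding DeMoivre2 by (simp add: rcis_cmod_Arg)
  thus ?thesis by blast
qed

lemma equienergetic_gen_paley_complement: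
  assumes "2 * Re jacobi \<ge> 6"
  shows "equienergetic (gen_paley 3 R) (complement_graph (gen_paley 3 R))"
proof -
  obtain \<gamma> where \<gamma>: "\<gamma> ^ 3 = q * jacobi" using cube_root_exists by blast
  let ?Q = "real (card (carrier R))"
  have exp: "(\<Sum>z\<in>#{#a#} + (\<Sum>k<3. replicate_mset n (of_real (r k))). cmod z)
    = cmod a + real n * (\<Sum>k<3. \<bar>r k\<bar>)" for a and r :: "nat \<Rightarrow> real"
    by (simp add: eval_nat_numeral algebra_simps)
  have "(\<Sum>k<3. \<bar>eig \<gamma> k - 1\<bar>) = 3 + (\<Sum>k<3. \<bar>eig \<gamma> k + 2\<bar>)"
    by (rule cubic_sign_energy[of ?Q "2 * Re jacobi"]) (use assms eig_cubic[OF \<gamma>] card_carrier in auto)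
  moreover have "\<bar>- (x + 2) / 3\<bar> = \<bar>x + 2\<bar> / 3" "\<bar>(x - 1) / 3\<bar> = \<bar>x - 1\<bar> / 3" for x :: real
    by (auto simp: abs_if field_simps)
  ultimately have "(\<Sum>k<3. \<bar>(eig \<gamma> k - 1) / 3\<bar>) = 1 + (\<Sum>k<3. \<bar>- (eig \<gamma> k + 2) / 3\<bar>)"
    by (simp only: sum_divide_distrib [symmetric]) simp
  thus ?thesis
    unfolding equienergetic_def graph_energy_def spectrum_gen_paley[OF \<gamma>]
      spectrum_complement_gen_paley[OF \<gamma>] exp by (simp add: algebra_simps)
qed

text \<open>The valency \<open>2 * n\<close> of the complement would have to be
  \<open>(eig \<gamma> k - 1) / 3\<close>, forcing \<open>eig \<gamma> k = 6 * n + 1\<close> against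
  the bound by twice the square root of the field order.\<close>

lemma not_isospectral_gen_paley_complement:
  "\<not> isospectral (gen_paley 3 R) (complement_graph (gen_paley 3 R))"
proof
  obtain \<gamma> where \<gamma>: "\<gamma> ^ 3 = q * jacobi" using cube_root_exists by blast
  let ?Q = "real (card (carrier R))"
  assume "isospectral (gen_paley 3 R) (complement_graph (gen_paley 3 R))"
  moreover have "of_nat (2 * n) \<in># graph_spectrum (complement_graph (gen_paley 3 R))"
    by (simp add: spectrum_complement_gen_paley[OF \<gamma>])
  ultimately have "complex_of_nat (2 * n) \<in># graph_spectrum (gen_paley 3 R)"
    by (simp add: isospectral_def)
  hence "complex_of_nat (2 * n) = of_nat n \<or> (\<exists>k. complex_of_nat (2 * n) = of_real ((eig \<gamma> k - 1) / 3))"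
    unfolding spectrum_gen_paley[OF \<gamma>] by (auto simp: eval_nat_numeral split: if_splits)
  moreover have "complex_of_nat (2 * n) \<noteq> of_nat n" using n_pos by (simp only: of_nat_eq_iff)
  ultimately obtain k where "complex_of_real (real (2 * n)) = of_real ((eig \<gamma> k - 1) / 3)" by auto
  hence "real (2 * n) = (eig \<gamma> k - 1) / 3" by (simp only: of_real_eq_iff)
  hence "eig \<gamma> k = 6 * real n + 1" by simp
  hence "(6 * real n + 1)\<^sup>2 \<le> 4 * (3 * real n + 1)"
    using eig_cubic(2)[OF \<gamma>, of k] by (simp add: card_carrier algebra_simps)
  moreover have "(real n)\<^sup>2 \<ge> 1" using n_pos by (intro one_le_power) simp
  ultimately show False by (simp add: power2_eq_square algebra_simps)
qed

section \<open>Arithmetic of the Jacobi sum\<close>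

definition jacobi_level :: "nat \<Rightarrow> 'a set" where
  "jacobi_level k = {x \<in> carrier R - {\<zero>, \<one>}. \<chi> x * \<chi> (\<one> \<ominus> x) = \<omega> ^ k}"

lemma finite_jacobi_level: "finite (jacobi_level k)"
  using finite_carrier by (simp add: jacobi_level_def)

lemma one_minus_nonzero:
  assumes "x \<in> carrier R" "x \<noteq> \<one>"
  shows "\<one> \<ominus> x \<noteq> \<zero>"
  using assms by (metis minus_minus_cancel one_closed minus_eq minus_zero r_zero)

text \<open>The target of \<open>f\<close> is a general semiring because the lemma serves to count
  elements, to expand the Jacobi sum and to evaluate an integer-valued indicator.\<close>

lemma sum_jacobi_level:
  fixes f :: "complex \<Rightarrow> 'c :: comm_semiring_1"
  shows "(\<Sum>x\<in>carrier R - {\<zero>, \<one>}. f (\<chi> x * \<chi> (\<one> \<ominus> x)))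
    = (\<Sum>k<3. of_nat (card (jacobi_level k)) * f (\<omega> ^ k))"
proof -
  let ?T = "carrier R - {\<zero>, \<one>}"
  have "f (\<chi> x * \<chi> (\<one> \<ominus> x)) = (\<Sum>k<3. if x \<in> jacobi_level k then f (\<omega> ^ k) else 0)"
    if x: "x \<in> ?T" for x
  proof -
    have "\<one> \<ominus> x \<noteq> \<zero>" using x one_minus_nonzero by blast
    then obtain i j :: nat where "x = g [^] i" "\<one> \<ominus> x = g [^] j"
      using x nonzero_obtain_power[of x] nonzero_obtain_power[of "\<one> \<ominus> x"] by (metis DiffE insertCI minus_closed one_closed)
    hence v: "\<chi> x * \<chi> (\<one> \<ominus> x) = \<omega> ^ (i + j)" by (simp add: chi_gen_power power_add)
    have "(x \<in> jacobi_level k) = (k = (i + j) mod 3)" if "k < 3" for k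
      using x that by (auto simp: jacobi_level_def v omega_power_eq_iff)
    hence "(\<Sum>k<3. if x \<in> jacobi_level k then f (\<omega> ^ k) else 0)
        = (\<Sum>k<3. if k = (i + j) mod 3 then f (\<omega> ^ k) else 0)"
      by (intro sum.cong) auto
    also have "\<dots> = f (\<omega> ^ (i + j))" by (simp add: omega_power_mod)
    finally show ?thesis unfolding v ..
  qed
  hence "(\<Sum>x\<in>?T. f (\<chi> x * \<chi> (\<one> \<ominus> x)))
      = (\<Sum>x\<in>?T. \<Sum>k<3. if x \<in> jacobi_level k then f (\<omega> ^ k) else 0)"
    by (intro sum.cong) auto
  also have "\<dots> = (\<Sum>k<3. \<Sum>x\<in>?T. if x \<in> jacobi_level k then f (\<omega> ^ k) else 0)"
    by (rule sum.swap)
  also have "\<dots> = (\<Sum>k<3. of_nat (card (jacobi_level k)) * f (\<omega> ^ k))"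
  proof (intro sum.cong refl)
    fix k
    have "?T \<inter> {x. x \<in> jacobi_level k} = jacobi_level k" by (auto simp: jacobi_level_def)
    thus "(\<Sum>x\<in>?T. if x \<in> jacobi_level k then f (\<omega> ^ k) else 0)
        = of_nat (card (jacobi_level k)) * f (\<omega> ^ k)"
      using finite_carrier by (simp add: sum.If_cases)
  qed
  finally show ?thesis .
qed

lemma card_jacobi_levels:
  "card (jacobi_level 0) + card (jacobi_level 1) + card (jacobi_level 2) + 2 = card (carrier R)"
proof -
  have "card (carrier R - {\<zero>, \<one>}) = card (jacobi_level 0) + card (jacobi_level 1) + card (jacobi_level 2)"
    using sum_jacobi_level[of "\<lambda>_. 1 :: nat"] by (simp add: eval_nat_numeral)
  moreover have "card (carrier R - {\<zero>, \<one>}) = card (carrier R) - card {\<zero>, \<one>}"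
    by (rule card_Diff_subset) auto
  moreover have "card {\<zero>, \<one>} \<le> card (carrier R)" using finite_carrier by (intro card_mono) auto
  moreover have "card {\<zero>, \<one>} = 2" by simp
  ultimately show ?thesis by linarith
qed

lemma jacobi_expand:
  "jacobi = of_nat (card (jacobi_level 0)) + of_nat (card (jacobi_level 1)) * \<omega> + of_nat (card (jacobi_level 2)) * \<omega>\<^sup>2"
proof -
  have "jacobi = (\<Sum>x\<in>carrier R - {\<zero>, \<one>}. \<chi> x * \<chi> (\<one> \<ominus> x))"
    unfolding jacobi_def using finite_carrier
    by (intro sum.mono_neutral_right) (auto simp: minus_eq r_neg)
  thus ?thesis using sum_jacobi_level[of "\<lambda>z. z"] by (simp add: eval_nat_numeral)
qed

text \<open>The map \<open>x \<mapsto> 1 / (1 - x)\<close> has order three and preserves \<open>\<chi> x * \<chi> (1 - x)\<close>; at a fixed point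
  this value is \<open>\<chi> 1 = 1\<close>.\<close>

lemma three_dvd_card_jacobi_level:
  assumes k: "\<not> 3 dvd k"
  shows "3 dvd card (jacobi_level k)"
proof (rule three_dvd_card_of_free_action[OF finite_jacobi_level])
  define f where "f x = inv (\<one> \<ominus> x)" for x
  have f: "f x \<in> carrier R" "(\<one> \<ominus> x) \<otimes> f x = \<one>" "f x \<noteq> \<zero>"
    if "x \<in> carrier R" "x \<noteq> \<one>" for x
  proof -
    have "\<one> \<ominus> x \<in> Units R" using that one_minus_nonzero[OF that] by (simp add: field_Units)
    thus "f x \<in> carrier R" "(\<one> \<ominus> x) \<otimes> f x = \<one>" by (simp_all add: f_def)
    thus "f x \<noteq> \<zero>" using that by auto
  qed
  have f_comp: "\<one> \<ominus> f x = \<ominus> (x \<otimes> f x)" if x: "x \<in> carrier R" "x \<noteq> \<one>" for x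
  proof -
    note fx = f[OF x]
    have "\<one> \<ominus> f x = (\<one> \<ominus> x) \<otimes> f x \<ominus> f x" by (simp only: fx(2))
    also have "(\<one> \<ominus> x) \<otimes> f x = f x \<oplus> \<ominus> (x \<otimes> f x)"
      using x fx by (simp add: minus_eq l_distr l_minus)
    also have "\<dots> \<ominus> f x = \<ominus> (x \<otimes> f x)"
      using x fx by (simp add: minus_eq a_comm[of "f x"] a_assoc r_neg)
    finally show ?thesis .
  qed
  show mem: "f x \<in> jacobi_level k" if x: "x \<in> jacobi_level k" for x
  proof -
    have x': "x \<in> carrier R" "x \<noteq> \<zero>" "x \<noteq> \<one>" "\<chi> x * \<chi> (\<one> \<ominus> x) = \<omega> ^ k"
      using x by (auto simp: jacobi_level_def)
    note fx = f[OF x'(1,3)] and fc = f_comp[OF x'(1,3)]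
    have "x \<otimes> f x \<noteq> \<zero>" using x' fx by (simp add: integral_iff)
    hence "\<one> \<ominus> f x \<noteq> \<zero>" unfolding fc using x' fx by (metis m_closed minus_minus minus_zero)
    hence ne: "f x \<noteq> \<one>" by (auto simp: minus_eq r_neg)
    \<comment> \<open>So \<open>\<chi> (f x)\<close> is the inverse of
      \<open>\<chi> (\<one> \<ominus> x)\<close>; being a cube root of unity, its square is
      \<open>\<chi> (\<one> \<ominus> x)\<close> again.\<close>
    have chi_f: "\<chi> (\<one> \<ominus> x) * \<chi> (f x) = 1"
      using fx x' chi_mult[of "\<one> \<ominus> x" "f x"] by simp
    have "\<chi> (\<one> \<ominus> x) * (\<chi> (f x) * \<chi> (f x)) = \<chi> (f x)"
      using chi_f by (simp flip: mult.assoc)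
    moreover have "\<chi> (f x) * \<chi> (f x) = cnj (\<chi> (f x))"
      using chi_square[OF fx(1)] by (simp add: power2_eq_square)
    moreover have "\<chi> (f x) * cnj (\<chi> (f x)) = 1" by (rule chi_mult_cnj[OF fx(1,3)])
    ultimately have "\<chi> (f x) * \<chi> (f x) = \<chi> (\<one> \<ominus> x)"
      by (metis mult.assoc mult.commute mult_1)
    moreover have "\<chi> (f x) * \<chi> (\<one> \<ominus> f x) = \<chi> x * (\<chi> (f x) * \<chi> (f x))"
      unfolding fc using x' fx by (simp add: chi_minus chi_mult)
    ultimately show ?thesis using fx ne x' by (simp add: jacobi_level_def)
  qed
  show "f (f (f x)) = x" if x: "x \<in> jacobi_level k" for x
  proof -
    define y z w where "y = f x" and "z = f y" and "w = f z"
    have lev: "x \<in> jacobi_level k" "y \<in> jacobi_level k" "z \<in> jacobi_level k" "w \<in> jacobi_level k"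
      using x mem by (simp_all add: y_def z_def w_def)
    hence car: "x \<in> carrier R" "y \<in> carrier R" "z \<in> carrier R" "w \<in> carrier R"
      and ne: "x \<noteq> \<one>" "y \<noteq> \<one>" "z \<noteq> \<one>" by (auto simp: jacobi_level_def)
    \<comment> \<open>Both \<open>x\<close> and \<open>w\<close> turn out to be inverses of
      \<open>\<ominus> (y \<otimes> z)\<close>.\<close>
    have "\<ominus> (x \<otimes> y) \<otimes> z = \<one>"
      using f(2)[OF car(2) ne(2)] f_comp[OF car(1) ne(1)] by (simp add: z_def y_def)
    hence 1: "x \<otimes> (\<ominus> (y \<otimes> z)) = \<one>" using car by (simp add: l_minus r_minus m_assoc)
    have "\<ominus> (y \<otimes> z) \<otimes> w = \<one>"
      using f(2)[OF car(3) ne(3)] f_comp[OF car(2) ne(2)] by (simp add: w_def z_def)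
    hence "x = w"
      using 1 car by (metis a_inv_closed inv_unique m_closed)
    thus ?thesis by (simp add: w_def z_def y_def)
  qed
  show "f x \<noteq> x" if x: "x \<in> jacobi_level k" for x
  proof
    assume fx: "f x = x"
    have x': "x \<in> carrier R" "x \<noteq> \<one>" "\<chi> x * \<chi> (\<one> \<ominus> x) = \<omega> ^ k"
      using x by (auto simp: jacobi_level_def)
    have "\<chi> (\<one> \<ominus> x) * \<chi> x = 1"
      using f(2)[OF x'(1,2)] x' chi_mult[of "\<one> \<ominus> x" x] by (simp add: fx)
    hence "\<omega> ^ k = 1" using x'(3) by (simp add: mult.commute)
    thus False using k by (simp add: omega_power_eq_1_iff)
  qed
qed

text \<open>With level sizes \<open>N0\<close>, \<open>N1\<close>, \<open>N2\<close> this is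
  \<open>2 * N0 - N1 - N2\<close>. It is written through \<open>N0\<close> alone because
  \<open>N0\<close> is the quantity that gets counted inside the field.\<close>

definition jacobi_trace :: int where
  "jacobi_trace = 3 * int (card (jacobi_level 0)) + 2 - int (card (carrier R))"

text \<open>Twice the imaginary part is \<open>sqrt 3\<close> times the difference of the sizes of
  levels 1 and 2. Both sizes are divisible by 3, which turns the coefficient 3 of the norm form into
  27.\<close>

lemma jacobi_trace_rep:
  shows "2 * Re jacobi = of_int jacobi_trace"
    and "\<exists>d :: int. jacobi_trace\<^sup>2 + 27 * d\<^sup>2 = 4 * int (card (carrier R))"
    and "jacobi_trace mod 3 = 1"
proof -
  let ?N = "\<lambda>k. int (card (jacobi_level k))"
  have c: "jacobi_trace = 2 * ?N 0 - ?N 1 - ?N 2"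
    using card_jacobi_levels by (simp add: jacobi_trace_def)
  show Re: "2 * Re jacobi = of_int jacobi_trace"
    unfolding jacobi_expand omega_sq c by (simp add: \<omega>_def)
  have Im: "2 * Im jacobi = sqrt 3 * of_int (?N 1 - ?N 2)"
    unfolding jacobi_expand omega_sq by (simp add: \<omega>_def algebra_simps)
  have "of_real ((cmod jacobi)\<^sup>2) = (of_nat (card (carrier R)) :: complex)"
    using jacobi_norm by (simp only: complex_norm_square)
  hence "(cmod jacobi)\<^sup>2 = real (card (carrier R))" by (metis of_real_eq_iff of_real_of_nat_eq)
  hence "(2 * Re jacobi)\<^sup>2 + (2 * Im jacobi)\<^sup>2 = 4 * real (card (carrier R))"
    unfolding cmod_power2 power_mult_distrib by simp
  hence "real_of_int (jacobi_trace\<^sup>2 + 3 * (?N 1 - ?N 2)\<^sup>2) = of_int (4 * int (card (carrier R)))"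
    unfolding Re Im by (simp add: power_mult_distrib)
  hence norm: "jacobi_trace\<^sup>2 + 3 * (?N 1 - ?N 2)\<^sup>2 = 4 * int (card (carrier R))"
    by (simp only: of_int_eq_iff)
  have dvd: "3 dvd ?N 1" "3 dvd ?N 2"
    using three_dvd_card_jacobi_level[of 1] three_dvd_card_jacobi_level[of 2] by presburger+
  then obtain d where "?N 1 - ?N 2 = 3 * d" by (meson dvd_diff dvdE)
  hence "jacobi_trace\<^sup>2 + 27 * d\<^sup>2 = 4 * int (card (carrier R))" using norm by (simp add: power_mult_distrib)
  thus "\<exists>d :: int. jacobi_trace\<^sup>2 + 27 * d\<^sup>2 = 4 * int (card (carrier R))" by blast
  show "jacobi_trace mod 3 = 1" using card_carrier unfolding jacobi_trace_def by presburger
qed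

section \<open>The Jacobi trace modulo the characteristic\<close>

definition \<iota> :: "int \<Rightarrow> 'a" where "\<iota> k = [k] \<cdot> \<one>"

lemma iota_closed [simp]: "\<iota> k \<in> carrier R" by (simp add: \<iota>_def)

lemma iota_0 [simp]: "\<iota> 0 = \<zero>" and iota_1 [simp]: "\<iota> 1 = \<one>"
  by (simp_all add: \<iota>_def add_pow_int_ge)

lemma iota_add: "\<iota> (a + b) = \<iota> a \<oplus> \<iota> b"
  unfolding \<iota>_def by (rule add.int_pow_mult) simp

lemma iota_mult_zero: "\<iota> b = \<zero> \<Longrightarrow> \<iota> (b * a) = \<zero>"
  unfolding \<iota>_def by (metis add.int_pow_pow add.int_pow_one one_closed)

lemma iota_card: "\<iota> (int (card (carrier R))) = \<zero>"
proof -
  have "[card (carrier R)] \<cdot> \<one> = \<zero>"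
    using add.pow_order_eq_1[of \<one>] by (simp add: Coset.order_def)
  thus ?thesis by (simp add: \<iota>_def add_pow_int_ge)
qed

lemma iota_eq_zero_imp_dvd:
  assumes p: "Factorial_Ring.prime (p :: nat)" "card (carrier R) = p ^ N" and k: "\<iota> k = \<zero>"
  shows "int p dvd k"
proof (rule ccontr)
  assume "\<not> int p dvd k"
  hence "coprime (int p) k" using p(1) by (simp add: prime_imp_coprime)
  hence "coprime k (int p ^ N)" by (simp add: coprime_commute)
  then obtain u v where uv: "k * u + int p ^ N * v = 1"
    using bezout_int[of k "int p ^ N"] by (auto simp: coprime_iff_gcd_eq_1 mult.commute)
  have "\<iota> (int p ^ N) = \<zero>" using iota_card p(2) by simp
  hence "\<iota> (k * u + int p ^ N * v) = \<zero>" using k by (simp add: iota_add iota_mult_zero)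
  thus False unfolding uv by simp
qed

lemma finsum_iota: "finite A \<Longrightarrow> (\<Oplus>x\<in>A. \<iota> (f x)) = \<iota> (\<Sum>x\<in>A. f x)"
  by (induction A rule: finite_induct) (simp_all add: iota_add)

text \<open>Replacing \<open>x\<close> by \<open>g \<otimes> x\<close> multiplies the sum by
  \<open>g [^] a\<close>, so it vanishes unless that power is one. Otherwise every nonzero
  \<open>x\<close> contributes one, while zero contributes nothing because
  \<open>a > 0\<close>.\<close>

lemma finsum_power:
  assumes "a > 0"
  shows "(\<Oplus>x\<in>carrier R. x [^] (a :: nat)) = \<iota> (if 3 * n dvd a then - 1 else 0)"
proof (cases "3 * n dvd a")
  case True
  have "x [^] a = \<iota> (if x = \<zero> then 0 else 1)" if x: "x \<in> carrier R" for x
  proof (cases "x = \<zero>")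
    case False
    then obtain i :: nat where "x = g [^] i" using x nonzero_obtain_power by metis
    moreover have "g [^] (i * a) = \<one>" using True by (simp add: gen_power_eq_one_iff)
    ultimately show ?thesis using False gen(1) by (simp add: nat_pow_pow)
  qed (use assms in \<open>simp add: nat_pow_zero\<close>)
  hence "(\<Oplus>x\<in>carrier R. x [^] a) = (\<Oplus>x\<in>carrier R. \<iota> (if x = \<zero> then 0 else 1))"
    by (intro finsum_cong') auto
  also have "\<dots> = \<iota> (\<Sum>x\<in>carrier R. if x = \<zero> then 0 else 1)"
    by (rule finsum_iota[OF finite_carrier])
  also have "(\<Sum>x\<in>carrier R. if x = \<zero> then 0 else 1 :: int) = (\<Sum>x\<in>carrier R - {\<zero>}. 1)"
    using finite_carrier by (intro sum.mono_neutral_cong_right) auto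
  also have "\<dots> = int (card (carrier R)) + - 1"
    using finite_carrier card_carrier by (simp add: card_Diff_singleton)
  also have "\<iota> (int (card (carrier R)) + - 1) = \<iota> (- 1)" unfolding iota_add iota_card by simp
  finally show ?thesis using True by simp
next
  case False
  let ?S = "\<Oplus>x\<in>carrier R. x [^] a"
  have g0: "g \<noteq> \<zero>" using gen_power(2)[of 1] gen(1) by simp
  have inj: "inj_on (\<lambda>x. g \<otimes> x) (carrier R)"
    using g0 gen(1) by (intro inj_onI) (metis m_lcancel)
  have "(\<lambda>x. g \<otimes> x) ` carrier R = carrier R"
    using gen(1) by (intro endo_inj_surj[OF finite_carrier _ inj]) auto
  hence "?S = (\<Oplus>x\<in>(\<lambda>x. g \<otimes> x) ` carrier R. x [^] a)" by simp
  also have "\<dots> = (\<Oplus>x\<in>carrier R. (g \<otimes> x) [^] a)"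
    using gen(1) inj by (intro finsum_reindex) auto
  also have "\<dots> = (\<Oplus>x\<in>carrier R. g [^] a \<otimes> x [^] a)"
    using gen(1) by (intro finsum_cong') (auto simp: nat_pow_distrib)
  also have "\<dots> = g [^] a \<otimes> ?S"
    by (intro finsum_rdistr[symmetric]) (auto simp: finite_carrier)
  finally have S: "?S \<otimes> \<one> = ?S \<otimes> g [^] a" by (simp add: m_comm finsum_closed)
  have "?S = \<zero>"
  proof (rule ccontr)
    assume "?S \<noteq> \<zero>"
    hence "g [^] a = \<one>" using S by (metis (no_types, lifting) m_lcancel finsum_closed gen_power(1) nat_pow_closed one_closed Pi_I')
    thus False using False by (simp add: gen_power_eq_one_iff)
  qed
  thus ?thesis using False by simp
qed

text \<open>A finite-field analogue of the Beta integral; its recurrence replaces binomial expansion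
  in the field.\<close>

definition beta :: "nat \<Rightarrow> nat \<Rightarrow> 'a" where
  "beta a b = (\<Oplus>x\<in>carrier R. x [^] a \<otimes> (\<one> \<ominus> x) [^] b)"

lemma beta_closed: "beta a b \<in> carrier R"
  unfolding beta_def by (intro finsum_closed) auto

lemma beta_split: "beta a b = beta a (Suc b) \<oplus> beta (Suc a) b"
proof -
  have "beta a (Suc b) \<oplus> beta (Suc a) b = (\<Oplus>x\<in>carrier R.
      x [^] a \<otimes> (\<one> \<ominus> x) [^] Suc b \<oplus> x [^] Suc a \<otimes> (\<one> \<ominus> x) [^] b)"
    unfolding beta_def by (intro finsum_addf[symmetric]) auto
  also have "\<dots> = beta a b"
    unfolding beta_def
  proof (intro finsum_cong')
    fix x assume x: "x \<in> carrier R"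
    let ?A = "x [^] a" and ?B = "(\<one> \<ominus> x) [^] b"
    have "?A \<otimes> (\<one> \<ominus> x) [^] Suc b \<oplus> x [^] Suc a \<otimes> ?B = ?A \<otimes> ?B \<otimes> ((\<one> \<ominus> x) \<oplus> x)"
      using x by (simp add: r_distr m_ac)
    also have "(\<one> \<ominus> x) \<oplus> x = \<one>" using x by (simp add: minus_eq a_assoc l_neg)
    finally show "?A \<otimes> (\<one> \<ominus> x) [^] Suc b \<oplus> x [^] Suc a \<otimes> ?B = ?A \<otimes> ?B" using x by simp
  qed auto
  finally show ?thesis ..
qed

text \<open>Minus the coefficient of \<open>x ^ (3 * n)\<close> in
  \<open>x ^ a * (1 - x) ^ b\<close>; with this reading the recurrence is Pascal's rule.\<close>

definition beta_val :: "nat \<Rightarrow> nat \<Rightarrow> int" where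
  "beta_val a b = (if a \<le> 3 * n then (- 1) ^ Suc (3 * n - a) * int (b choose (3 * n - a)) else 0)"

lemma beta_val_Suc: "beta_val a b = beta_val a (Suc b) + beta_val (Suc a) b"
proof (cases "a < 3 * n")
  case True
  then obtain r where r: "3 * n - a = Suc r" "3 * n - Suc a = r"
    by (metis Suc_diff_Suc)
  thus ?thesis using True by (simp add: beta_val_def algebra_simps)
qed (auto simp: beta_val_def)

text \<open>Below \<open>6 * n\<close>, twice the order of the multiplicative group,
  \<open>3 * n\<close> is the only positive exponent whose power sum survives. The recurrence never
  increases \<open>a + b\<close>.\<close>

lemma beta_eq:
  assumes "a > 0" "a + b < 6 * n"
  shows "beta a b = \<iota> (beta_val a b)"
  using assms
proof (induction b arbitrary: a)
  case 0
  have "beta a 0 = (\<Oplus>x\<in>carrier R. x [^] a)"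
    unfolding beta_def by (intro finsum_cong') auto
  also have "\<dots> = \<iota> (if 3 * n dvd a then - 1 else 0)" by (rule finsum_power[OF 0(1)])
  also have "3 * n dvd a \<longleftrightarrow> a = 3 * n"
  proof
    assume "3 * n dvd a"
    then obtain k where k: "a = 3 * n * k" by blast
    hence "k \<noteq> 0" using 0 by auto
    moreover have "3 * n * k < 3 * n * 2" using 0 k by simp
    hence "k < 2" by (simp only: mult_less_cancel1)
    ultimately show "a = 3 * n" using k by simp
  qed simp
  also have "(if a = 3 * n then - 1 else 0) = beta_val a 0"
    by (auto simp: beta_val_def)
  finally show ?case .
next
  case (Suc b)
  have "\<iota> (beta_val a (Suc b)) \<oplus> \<iota> (beta_val (Suc a) b) = \<iota> (beta_val a b)"
    by (simp add: beta_val_Suc[of a b] iota_add)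
  also have "\<dots> = beta a b" using Suc by simp
  also have "\<dots> = beta a (Suc b) \<oplus> \<iota> (beta_val (Suc a) b)"
    using Suc by (simp add: beta_split[of a b])
  finally show ?case
    by (metis add.right_cancel iota_closed beta_closed)
qed

text \<open>For nonzero \<open>u\<close> the power \<open>u [^] n\<close> is a cube root of unity in
  the field, equal to one exactly on cubes. The value 1 at zero makes the right side the number of
  cube roots of \<open>u\<close>.\<close>

lemma cube_indicator:
  assumes u: "u \<in> carrier R"
  shows "\<one> \<oplus> u [^] n \<oplus> u [^] (2 * n) = \<iota> (if u = \<zero> then 1 else if \<chi> u = 1 then 3 else 0)"
proof (cases "u = \<zero>")
  case True
  thus ?thesis using n_pos by (simp add: nat_pow_zero)
next
  case False
  then obtain i :: nat where i: "u = g [^] i" using u nonzero_obtain_power by metis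
  let ?t = "u [^] n"
  have t: "?t \<in> carrier R" using u by simp
  have t2: "u [^] (2 * n) = ?t \<otimes> ?t" using u by (simp add: mult_2 nat_pow_mult)
  have t3: "?t \<otimes> ?t \<otimes> ?t = \<one>"
  proof -
    have "3 * n = n + n + n" by simp
    hence "?t \<otimes> ?t \<otimes> ?t = u [^] (3 * n)" using u by (simp only: nat_pow_mult)
    also have "\<dots> = g [^] (i * (3 * n))" unfolding i using gen(1) by (rule nat_pow_pow)
    also have "\<dots> = \<one>" by (simp only: gen_power_eq_one_iff) simp
    finally show ?thesis .
  qed
  have t1: "?t = \<one> \<longleftrightarrow> \<chi> u = 1"
  proof -
    have "?t = g [^] (i * n)" unfolding i using gen(1) by (rule nat_pow_pow)
    hence "?t = \<one> \<longleftrightarrow> 3 * n dvd i * n" by (simp only: gen_power_eq_one_iff)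
    thus ?thesis using n_pos by (simp add: i chi_gen_power omega_power_eq_1_iff)
  qed
  show ?thesis
  proof (cases "\<chi> u = 1")
    case True
    have "\<iota> 3 = \<iota> (1 + 1 + 1)" by simp
    also have "\<dots> = \<one> \<oplus> \<one> \<oplus> \<one>" by (simp only: iota_add iota_1)
    finally show ?thesis using True t1 False by (simp add: t2)
  next
    case chi: False
    let ?S = "\<one> \<oplus> ?t \<oplus> ?t \<otimes> ?t"
    have "?S \<otimes> ?t = ?t \<oplus> ?t \<otimes> ?t \<oplus> \<one>" using t t3 by (simp add: l_distr)
    also have "\<dots> = ?S \<otimes> \<one>" using t by (simp add: a_ac)
    finally have "?S \<otimes> ?t = ?S \<otimes> \<one>" .
    hence "?S = \<zero>" using t chi t1 by (metis m_lcancel a_closed m_closed one_closed)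
    thus ?thesis using chi False by (simp add: t2)
  qed
qed

text \<open>The points of the curve \<open>y^3 = x * (1 - x)\<close> are counted twice. The integer
  count is \<open>2 + 3 * card (jacobi_level 0)\<close>. In the field, the term with exponent
  \<open>n\<close> has degree below \<open>3 * n\<close> and sums to zero, while exponent
  \<open>2 * n\<close> leaves the central binomial coefficient.\<close>

lemma iota_jacobi_trace:
  "\<iota> (jacobi_trace + (- 1) ^ n * int ((2 * n) choose n)) = \<zero>"
proof -
  let ?u = "\<lambda>x. x \<otimes> (\<one> \<ominus> x)"
  let ?h = "\<lambda>x. if ?u x = \<zero> then 1 else if \<chi> (?u x) = 1 then 3 else 0 :: int"
  have pow: "beta k k = (\<Oplus>x\<in>carrier R. ?u x [^] k)" for k
    unfolding beta_def by (intro finsum_cong') (auto simp: nat_pow_distrib)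
  have "(\<Oplus>x\<in>carrier R. \<one> \<oplus> ?u x [^] n \<oplus> ?u x [^] (2 * n))
      = (\<Oplus>x\<in>carrier R. \<iota> 1) \<oplus> beta n n \<oplus> beta (2 * n) (2 * n)"
    unfolding pow by (subst finsum_addf, simp, simp, subst finsum_addf) auto
  also have "\<dots> = \<zero> \<oplus> \<iota> (beta_val n n) \<oplus> \<iota> (beta_val (2 * n) (2 * n))"
    using n_pos finsum_iota[OF finite_carrier, of "\<lambda>_. 1"] by (simp add: beta_eq iota_card)
  also have "\<dots> = \<iota> (- ((- 1) ^ n * int ((2 * n) choose n)))"
  proof -
    have "beta_val n n = 0" using n_pos by (simp add: beta_val_def)
    moreover have "beta_val (2 * n) (2 * n) = - ((- 1) ^ n * int ((2 * n) choose n))"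
      by (simp add: beta_val_def)
    ultimately show ?thesis by simp
  qed
  finally have 1: "(\<Oplus>x\<in>carrier R. \<one> \<oplus> ?u x [^] n \<oplus> ?u x [^] (2 * n))
    = \<iota> (- ((- 1) ^ n * int ((2 * n) choose n)))" .
  have "(\<Oplus>x\<in>carrier R. \<one> \<oplus> ?u x [^] n \<oplus> ?u x [^] (2 * n)) = (\<Oplus>x\<in>carrier R. \<iota> (?h x))"
    by (intro finsum_cong') (auto simp: cube_indicator)
  also have "\<dots> = \<iota> (\<Sum>x\<in>carrier R. ?h x)" by (rule finsum_iota[OF finite_carrier])
  also have "(\<Sum>x\<in>carrier R. ?h x) = 2 + 3 * int (card (jacobi_level 0))"
  proof -
    have "(\<Sum>x\<in>carrier R. ?h x) = (\<Sum>x\<in>{\<zero>, \<one>}. ?h x) + (\<Sum>x\<in>carrier R - {\<zero>, \<one>}. ?h x)"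
      using finite_carrier by (subst sum.subset_diff[of "{\<zero>, \<one>}"]) auto
    also have "(\<Sum>x\<in>{\<zero>, \<one>}. ?h x) = 2" by (simp add: minus_eq r_neg)
    also have "(\<Sum>x\<in>carrier R - {\<zero>, \<one>}. ?h x)
        = (\<Sum>x\<in>carrier R - {\<zero>, \<one>}. if \<chi> x * \<chi> (\<one> \<ominus> x) = 1 then 3 else 0)"
    proof (intro sum.cong refl)
      fix x assume "x \<in> carrier R - {\<zero>, \<one>}"
      hence x: "x \<in> carrier R" "x \<noteq> \<zero>" "x \<noteq> \<one>" by auto
      hence "?u x \<noteq> \<zero>" using one_minus_nonzero[of x] by (simp add: integral_iff)
      thus "?h x = (if \<chi> x * \<chi> (\<one> \<ominus> x) = 1 then 3 else 0)" using x by (simp add: chi_mult)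
    qed
    also have "\<dots> = 3 * int (card (jacobi_level 0))"
    proof -
      have "\<omega> ^ k = 1 \<longleftrightarrow> k = 0" if "k < 3" for k
        using that by (auto simp: omega_power_eq_1_iff dvd_imp_le dest: dvd_imp_le)
      hence "(\<Sum>k<3. of_nat (card (jacobi_level k)) * (if \<omega> ^ k = 1 then 3 else 0))
          = (\<Sum>k<3. if k = (0 :: nat) then 3 * int (card (jacobi_level 0)) else 0)"
        by (intro sum.cong) auto
      thus ?thesis unfolding sum_jacobi_level[of "\<lambda>z. if z = 1 then 3 else 0 :: int"] by simp
    qed
    finally show ?thesis .
  qed
  finally have "\<iota> (2 + 3 * int (card (jacobi_level 0))) = \<iota> (- ((- 1) ^ n * int ((2 * n) choose n)))"
    using 1 by simp
  moreover have "2 + 3 * int (card (jacobi_level 0)) = jacobi_trace + int (card (carrier R))"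
    by (simp add: jacobi_trace_def)
  ultimately have "\<iota> jacobi_trace = \<iota> (- ((- 1) ^ n * int ((2 * n) choose n)))"
    by (simp add: iota_add iota_card)
  hence "\<iota> (jacobi_trace + (- 1) ^ n * int ((2 * n) choose n))
    = \<iota> (- ((- 1) ^ n * int ((2 * n) choose n)) + (- 1) ^ n * int ((2 * n) choose n))"
    by (simp only: iota_add)
  thus ?thesis by simp
qed

end

section \<open>Equienergetic complements\<close>

lemma cubic_field_exists:
  assumes "field F" "finite (carrier F)" "card (carrier F) = 3 * n + 1"
  shows "\<exists>g. cubic_field F g n"
proof -
  interpret field F by fact
  obtain g where g: "g \<in> carrier (mult_of F)" "carrier (mult_of F) = {g [^]\<^bsub>F\<^esub> i | i :: nat. i \<in> UNIV}"
    using finite_field_mult_group_has_gen[OF assms(2)] by blast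
  have "cubic_field F g n"
    by unfold_locales (use assms g in auto)
  thus ?thesis by blast
qed

text \<open>All that the number theory needs to know about a field: as non-isospectrality is
  unconditional, a failure of the conclusion forces \<open>c < 6\<close>.\<close>

lemma gen_paley_cubic_dichotomy:
  fixes F :: "('a, 'b) ring_scheme"
  assumes F: "field F" "card (carrier F) = p ^ N" and p: "Factorial_Ring.prime p" "p mod 3 = 1" and N: "N > 0"
  shows "\<exists>c d :: int. c\<^sup>2 + 27 * d\<^sup>2 = 4 * int p ^ N \<and> c mod 3 = 1 \<and> \<not> int p dvd c \<and>
    (c \<ge> 6 \<longrightarrow> equienergetic (gen_paley 3 F) (complement_graph (gen_paley 3 F))) \<and>
    \<not> isospectral (gen_paley 3 F) (complement_graph (gen_paley 3 F))"
proof -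
  define n where "n = p ^ N div 3"
  have "p ^ N mod 3 = 1" by (subst power_mod [symmetric]) (simp add: p(2))
  hence n: "3 * n + 1 = p ^ N" unfolding n_def by presburger
  have e: "p = 3 * (p div 3) + 1" using p(2) by presburger
  \<comment> \<open>An infinite carrier would have \<open>card\<close> equal to 0 by
    convention.\<close>
  have fin: "finite (carrier F)" by (intro card_ge_0_finite) (simp add: F(2) flip: n)
  obtain g where "cubic_field F g n" using cubic_field_exists[OF F(1) fin F(2)[folded n]] by blast
  then interpret cubic_field F g n .
  have "\<not> int p dvd jacobi_trace"
  proof
    assume "int p dvd jacobi_trace"
    moreover have "int p dvd jacobi_trace + (- 1) ^ n * int ((2 * n) choose n)"
      by (rule iota_eq_zero_imp_dvd[OF p(1) F(2) iota_jacobi_trace])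
    ultimately have "int p dvd (- 1) ^ n * int ((2 * n) choose n)" by (simp add: dvd_add_right_iff)
    hence "p dvd ((2 * n) choose n)" by (cases "even n") auto
    thus False using prime_not_dvd_central_binomial[OF p(1) e n] by blast
  qed
  moreover have "6 \<le> 2 * Re jacobi" if "jacobi_trace \<ge> 6"
    unfolding jacobi_trace_rep(1) using that by linarith
  ultimately show ?thesis
    using jacobi_trace_rep(2,3) equienergetic_gen_paley_complement not_isospectral_gen_paley_complement F(2)
    by (metis of_nat_power)
qed

theorem theorem5p1:
  fixes p t :: nat
  assumes "Factorial_Ring.prime p" and "[p = 1] (mod 3)"
    and "\<exists>x y :: int. int p ^ t = x\<^sup>2 + 27 * y\<^sup>2 \<and> coprime x (int p)"
  shows "\<forall>s \<in> {0..<t}. infinite {l :: nat.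
           \<forall>F :: nat ring. field F \<and> card (carrier F) = p ^ (3 * (t * l + s)) \<longrightarrow>
             equienergetic (gen_paley 3 F) (complement_graph (gen_paley 3 F)) \<and>
             \<not> isospectral (gen_paley 3 F) (complement_graph (gen_paley 3 F))}"
proof (intro ballI notI)
  fix s assume s: "s \<in> {0..<t}"
  let ?good = "\<lambda>l. \<forall>F :: nat ring. field F \<and> card (carrier F) = p ^ (3 * (t * l + s)) \<longrightarrow>
    equienergetic (gen_paley 3 F) (complement_graph (gen_paley 3 F)) \<and>
    \<not> isospectral (gen_paley 3 F) (complement_graph (gen_paley 3 F))"
  assume "finite {l. ?good l}"
  \<comment> \<open>Every \<open>l\<close> beyond \<open>L\<close> fails, which yields
    representations with \<open>c < 6\<close> for all of them: the bounded family already
    excluded.\<close>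
  then obtain L where L: "\<And>l. ?good l \<Longrightarrow> l \<le> L" by (auto simp: finite_nat_set_iff_bounded_le)
  have t: "t > 0" using s by simp
  have p3: "p mod 3 = 1" using assms(2) by (simp add: cong_def)
  obtain x y where xy: "int p ^ t = x\<^sup>2 + 27 * y\<^sup>2" "coprime x (int p)" using assms(3) by blast
  show False
  proof (rule no_bounded_family_of_reps)
    show "Factorial_Ring.prime (int p)" using assms(1) by simp
    show "int p mod 3 = 1" using p3 by presburger
    show "\<not> int p dvd x"
      using xy(2) assms(1) by (metis coprime_absorb_right not_prime_unit prime_int_nat_transfer prime_nat_int_transfer)
    show "t > 0" "Suc L > 0" by (simp_all add: t)
    show "int p ^ t = x\<^sup>2 + 27 * y\<^sup>2" by (rule xy(1))
    show "\<exists>c d. c\<^sup>2 + 27 * d\<^sup>2 = 4 * int p ^ (3 * (t * l + s)) \<and> c mod 3 = 1 \<and> \<not> int p dvd c \<and> c < 6"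
      if l: "Suc L \<le> l" for l
    proof -
      \<comment> \<open>The failure at \<open>l\<close> itself supplies a field, so no finite field has to be constructed.\<close>
      obtain F :: "nat ring" where F: "field F" "card (carrier F) = p ^ (3 * (t * l + s))"
        and bad: "\<not> (equienergetic (gen_paley 3 F) (complement_graph (gen_paley 3 F)) \<and>
          \<not> isospectral (gen_paley 3 F) (complement_graph (gen_paley 3 F)))"
        using L[of l] l by auto
      have "3 * (t * l + s) > 0" using t l by simp
      from gen_paley_cubic_dichotomy[OF F assms(1) p3 this] bad show ?thesis
        by (meson not_le)
    qed
  qed
qed

end
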